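(* Let $1\le p<\infty$ and let $(X,d,\mu)$ be a compact Cheeger space for the exponent $p$. Let $\{r_n\}_{n\ge1}$ be a sequence of positive numbers converging to zero along which $\{E_{p,r_n}\}_{n\ge 1}$ $\Gamma$-converges in $L^p(X,\mu)$ to the $p$-energy $\mathcal{E}_p$. Then the sequence of functionals $\{E_{p,r_n}\}_{n\ge1}$ Mosco converges to $\mathcal{E}_p$.
   Context: Cheeger space (for $1\le p<\infty$): a locally compact, complete metric space $(X,d)$ with a Radon measure $\mu$ such that, writing $B(x,r)=\{y:d(x,y)<r\}$: (VD) there is $C>0$ with $0<\mu(B(x,2r))\le C\mu(B(x,r))<\infty$ for all $x\in X$, $r>0$; (PI) there are $C>0$, $\lambda\ge1$ such that for every Lipschitz $f$ on $X$ and every ball $B(x,R)$, $\int_{B(x,R)}|f-f_{B(x,R)}|^p d\mu\le CR^p\int_{B(x,\lambda R)}(\mathrm{Lip} f)^p d\mu$, where $f_B=\frac1{\mu(B)}\int_B f\,d\mu$ and $(\mathrm{Lip} f)(y)=\limsup_{r\to0^+}\sup_{d(x,y)\le r}\frac{|f(x)-f(y)|}{r}$. Energies: for $r>0$ and $f\in L^p(X,\mu)$, $E_{p,r}(f)=\frac1{r^p}\int_X\frac1{\mu(B(x,r))}\int_{B(x,r)}|f(y)-f(x)|^p d\mu(y)d\mu(x)$. $\Gamma$-convergence: $E_n\colon L^p(X,\mu)\to[-\infty,\infty]$ $\Gamma$-converge to $E$ if (i) $E(f)\le\liminf_n E_n(f_n)$ whenever $f_n\to f$ strongly in $L^p(X,\mu)$,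 and (ii) for every $f\in L^p(X,\mu)$ there is $f_n\to f$ strongly in $L^p(X,\mu)$ with $\limsup_n E_n(f_n)\le E(f)$. Mosco convergence: the same with (i) required for all sequences $f_n\to f$ converging weakly in $L^p(X,\mu)$. The limit $\mathcal{E}_p\colon L^p(X,\mu)\to[0,\infty]$ is finite exactly on $KS^{1,p}(X)=\{f\in L^p(X,\mu):\limsup_{r\to0^+}E_{p,r}(f)<\infty\}$. *)

theory Defs
  imports "HOL-Analysis.Analysis"
begin

text \<open>
  A metric measure space is a type of class \<open>metric_space\<close> together with a Borel measure on it;
  the open ball of radius \<open>r\<close> around \<open>x\<close> is the library's \<open>ball x r\<close>.
\<close>

definition radon_measure :: "'a::topological_space measure \<Rightarrow> bool" where
  "radon_measure M \<longleftrightarrow>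
     sets M = sets borel \<and>
     (\<forall>K. compact K \<longrightarrow> emeasure M K < \<infinity>) \<and>
     (\<forall>A\<in>sets borel. emeasure M A = (INF U\<in>{U. open U \<and> A \<subseteq> U}. emeasure M U)) \<and>
     (\<forall>U. open U \<longrightarrow> emeasure M U = (SUP K\<in>{K. compact K \<and> K \<subseteq> U}. emeasure M K))"

definition volume_doubling :: "'a::metric_space measure \<Rightarrow> bool" where
  "volume_doubling M \<longleftrightarrow>
     (\<exists>C>0::real. \<forall>x. \<forall>r>0.
        0 < emeasure M (ball x (2 * r)) \<and>
        emeasure M (ball x (2 * r)) \<le> ennreal C * emeasure M (ball x r) \<and>
        ennreal C * emeasure M (ball x r) < \<infinity>)"

definition ball_average :: "'a::metric_space measure \<Rightarrow> 'a \<Rightarrow> real \<Rightarrow> ('a \<Rightarrow> real) \<Rightarrow> real" where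
  "ball_average M x R f = (LINT y:ball x R|M. f y) / measure M (ball x R)"

definition Lip :: "('a::metric_space \<Rightarrow> real) \<Rightarrow> 'a \<Rightarrow> ennreal" where
  "Lip f y = Limsup (at_right 0) (\<lambda>r::real. SUP x\<in>cball y r. ennreal (\<bar>f x - f y\<bar> / r))"

text \<open>
  In the Poincare inequality \<open>f\<close> is Lipschitz, so \<open>Lip f\<close> is bounded by the Lipschitz constant
  and the conversion \<open>enn2real\<close> loses nothing.
\<close>

definition poincare_inequality :: "'a::metric_space measure \<Rightarrow> real \<Rightarrow> bool" where
  "poincare_inequality M p \<longleftrightarrow>
     (\<exists>C>0::real. \<exists>\<Lambda>\<ge>1::real. \<forall>f::'a \<Rightarrow> real. (\<exists>L. L-lipschitz_on UNIV f) \<longrightarrow>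
        (\<forall>x. \<forall>R>0.
           (\<integral>\<^sup>+y\<in>ball x R. ennreal (\<bar>f y - ball_average M x R f\<bar> powr p) \<partial>M)
           \<le> ennreal (C * R powr p) *
              (\<integral>\<^sup>+y\<in>ball x (\<Lambda> * R). ennreal (enn2real (Lip f y) powr p) \<partial>M)))"

definition cheeger_space :: "'a::metric_space measure \<Rightarrow> real \<Rightarrow> bool" where
  "cheeger_space M p \<longleftrightarrow>
     locally_compact_space (euclidean :: 'a topology) \<and>
     complete (UNIV :: 'a set) \<and>
     radon_measure M \<and>
     volume_doubling M \<and>
     poincare_inequality M p"

text \<open>
  Elements of \<open>L\<^sup>p\<close> are handled through representatives: \<open>Lp\<close> is a set of functions, not of
  classes modulo almost everywhere equality. All notions below are unaffected by the choice of
  representative; in particular a \<open>\<Gamma>\<close>-limit in the sense below necessarily takes the same value on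
  functions that agree almost everywhere, since a recovery sequence for one of them also converges
  to the other.
\<close>

definition Lp :: "'a measure \<Rightarrow> real \<Rightarrow> ('a \<Rightarrow> real) set" where
  "Lp M p = {f \<in> borel_measurable M. integrable M (\<lambda>x. \<bar>f x\<bar> powr p)}"

definition Lp_norm :: "'a measure \<Rightarrow> real \<Rightarrow> ('a \<Rightarrow> real) \<Rightarrow> real" where
  "Lp_norm M p f = (LINT x|M. \<bar>f x\<bar> powr p) powr (1 / p)"

definition Lp_dual :: "'a measure \<Rightarrow> real \<Rightarrow> (('a \<Rightarrow> real) \<Rightarrow> real) set" where
  "Lp_dual M p = {\<phi>.
     (\<forall>f\<in>Lp M p. \<forall>g\<in>Lp M p. \<phi> (\<lambda>x. f x + g x) = \<phi> f + \<phi> g) \<and>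
     (\<forall>c. \<forall>f\<in>Lp M p. \<phi> (\<lambda>x. c * f x) = c * \<phi> f) \<and>
     (\<exists>K. \<forall>f\<in>Lp M p. \<bar>\<phi> f\<bar> \<le> K * Lp_norm M p f)}"

definition Lp_strong_conv ::
    "'a measure \<Rightarrow> real \<Rightarrow> (nat \<Rightarrow> 'a \<Rightarrow> real) \<Rightarrow> ('a \<Rightarrow> real) \<Rightarrow> bool" where
  "Lp_strong_conv M p fs f \<longleftrightarrow>
     (\<forall>n. fs n \<in> Lp M p) \<and> f \<in> Lp M p \<and>
     (\<lambda>n. Lp_norm M p (\<lambda>x. fs n x - f x)) \<longlonglongrightarrow> 0"

definition Lp_weak_conv ::
    "'a measure \<Rightarrow> real \<Rightarrow> (nat \<Rightarrow> 'a \<Rightarrow> real) \<Rightarrow> ('a \<Rightarrow> real) \<Rightarrow> bool" where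
  "Lp_weak_conv M p fs f \<longleftrightarrow>
     (\<forall>n. fs n \<in> Lp M p) \<and> f \<in> Lp M p \<and>
     (\<forall>\<phi>\<in>Lp_dual M p. (\<lambda>n. \<phi> (fs n)) \<longlonglongrightarrow> \<phi> f)"

definition gamma_converges ::
    "'a measure \<Rightarrow> real \<Rightarrow> (nat \<Rightarrow> ('a \<Rightarrow> real) \<Rightarrow> ereal) \<Rightarrow> (('a \<Rightarrow> real) \<Rightarrow> ereal) \<Rightarrow> bool" where
  "gamma_converges M p En E \<longleftrightarrow>
     (\<forall>fs f. Lp_strong_conv M p fs f \<longrightarrow> E f \<le> liminf (\<lambda>n. En n (fs n))) \<and>
     (\<forall>f\<in>Lp M p. \<exists>fs. Lp_strong_conv M p fs f \<and> limsup (\<lambda>n. En n (fs n)) \<le> E f)"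

definition mosco_converges ::
    "'a measure \<Rightarrow> real \<Rightarrow> (nat \<Rightarrow> ('a \<Rightarrow> real) \<Rightarrow> ereal) \<Rightarrow> (('a \<Rightarrow> real) \<Rightarrow> ereal) \<Rightarrow> bool" where
  "mosco_converges M p En E \<longleftrightarrow>
     (\<forall>fs f. Lp_weak_conv M p fs f \<longrightarrow> E f \<le> liminf (\<lambda>n. En n (fs n))) \<and>
     (\<forall>f\<in>Lp M p. \<exists>fs. Lp_strong_conv M p fs f \<and> limsup (\<lambda>n. En n (fs n)) \<le> E f)"

definition KS_energy :: "'a::metric_space measure \<Rightarrow> real \<Rightarrow> real \<Rightarrow> ('a \<Rightarrow> real) \<Rightarrow> ennreal" where
  "KS_energy M p r f =
     (\<integral>\<^sup>+x. (\<integral>\<^sup>+y\<in>ball x r. ennreal (\<bar>f y - f x\<bar> powr p) \<partial>M) / emeasure M (ball x r) \<partial>M)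
     / ennreal (r powr p)"

definition KS_space :: "'a::metric_space measure \<Rightarrow> real \<Rightarrow> ('a \<Rightarrow> real) set" where
  "KS_space M p = {f \<in> Lp M p. Limsup (at_right 0) (\<lambda>r. KS_energy M p r f) < \<infinity>}"

end

theory Submission
  imports Defs
begin

text \<open>
  Since the recovery sequences are the same, only the lower bound along a weakly convergent sequence
  \<open>f\<^sub>n\<close> is at stake, and it follows from the \<open>\<Gamma>\<close>-lower bound once bounded energy upgrades weak to
  strong convergence along the indices of small energy (at the other indices \<open>f\<^sub>n\<close> is replaced by the
  limit). Averaging \<open>f\<^sub>n\<close> against a tent kernel at scale \<open>r\<^sub>n\<close> gives a Lipschitz function that is
  close to \<open>f\<^sub>n\<close> and whose \<open>Lip\<close> is controlled in \<open>L\<^sup>p\<close> by the energy. The Poincare inequality on the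
  balls of an \<open>R\<close>-net, whose enlargements overlap boundedly by doubling, then bounds the distance
  of \<open>f\<^sub>n\<close> to its averages on these balls by a multiple of \<open>R\<close>, uniformly in \<open>n\<close> with \<open>r\<^sub>n \<le> R\<close>.
  These finitely many averages converge by weak convergence, so the sequence is Cauchy in \<open>L\<^sup>p\<close>, and
  weak lower semicontinuity of the norm identifies the strong limit without using completeness.
\<close>

section \<open>Integrals of nonmeasurable functions\<close>

text \<open>\<open>Lip f\<close> and the inner integral of \<open>KS_energy\<close> are not shown to be measurable, as the metric space
  is not of class \<open>second_countable_topology\<close>. Superadditivity and scaling of the (lower) integral
  do not need it.\<close>

lemma nn_integral_measurable_minorant:
  obtains G where "G \<in> borel_measurable M" "\<And>x. G x \<le> F x" "(\<integral>\<^sup>+x. F x \<partial>M) = (\<integral>\<^sup>+x. G x \<partial>M)"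
proof -
  let ?S = "{g. simple_function M g \<and> g \<le> F}"
  have ne: "?S \<noteq> {}"
    by (auto intro!: exI[of _ "\<lambda>_. 0"] simp: le_fun_def)
  \<comment> \<open>The lower integral is a supremum over simple minorants, so countably many of
    them already approach it; their pointwise supremum is the measurable minorant
    \<open>G\<close>.\<close>
  obtain s where s: "range s \<subseteq> integral\<^sup>S M ` ?S" "Sup (integral\<^sup>S M ` ?S) = (SUP i::nat. s i)"
    using ennreal_SUP_countable_SUP[OF ne, of "integral\<^sup>S M"] by auto
  have "\<forall>i. \<exists>g. g \<in> ?S \<and> s i = integral\<^sup>S M g"
    using s(1) by (simp add: image_iff subset_iff) (metis rangeI)
  then obtain g where g: "\<And>i. g i \<in> ?S" "\<And>i. s i = integral\<^sup>S M (g i)"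
    by metis
  define G where "G x = (SUP i. g i x)" for x
  have meas: "G \<in> borel_measurable M"
    unfolding G_def using g(1) by (intro borel_measurable_SUP) (auto intro: borel_measurable_simple_function)
  have le: "G x \<le> F x" for x
    unfolding G_def using g(1) by (intro SUP_least) (auto simp: le_fun_def)
  have "(\<integral>\<^sup>+x. F x \<partial>M) = (SUP i. s i)"
    using s(2) by (simp add: nn_integral_def)
  also have "\<dots> \<le> (\<integral>\<^sup>+x. G x \<partial>M)"
  proof (rule SUP_least)
    fix i
    have "s i = (\<integral>\<^sup>+x. g i x \<partial>M)"
      using g by (simp add: nn_integral_eq_simple_integral)
    also have "\<dots> \<le> (\<integral>\<^sup>+x. G x \<partial>M)"
      by (intro nn_integral_mono) (auto simp: G_def intro: SUP_upper)
    finally show "s i \<le> (\<integral>\<^sup>+x. G x \<partial>M)" .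
  qed
  finally have "(\<integral>\<^sup>+x. F x \<partial>M) = (\<integral>\<^sup>+x. G x \<partial>M)"
    using nn_integral_mono[of M G F] le by (intro antisym) auto
  with meas le that show thesis by blast
qed

text \<open>Each summand is replaced by a measurable minorant with the same integral. Minorants add
  up exactly, and their sum is a minorant of the full sum.\<close>

lemma nn_integral_superadditive:
  assumes "finite T"
  shows "(\<Sum>t\<in>T. \<integral>\<^sup>+x. F t x \<partial>M) \<le> (\<integral>\<^sup>+x. (\<Sum>t\<in>T. F t x) \<partial>M)"
proof -
  have "\<exists>G. G \<in> borel_measurable M \<and> (\<forall>x. G x \<le> F t x) \<and> (\<integral>\<^sup>+x. F t x \<partial>M) = (\<integral>\<^sup>+x. G x \<partial>M)" for t
    using nn_integral_measurable_minorant[of M "F t"] by metis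
  then obtain G where G: "\<And>t. G t \<in> borel_measurable M" "\<And>t x. G t x \<le> F t x"
    "\<And>t. (\<integral>\<^sup>+x. F t x \<partial>M) = (\<integral>\<^sup>+x. G t x \<partial>M)"
    by metis
  have "(\<Sum>t\<in>T. \<integral>\<^sup>+x. F t x \<partial>M) = (\<integral>\<^sup>+x. (\<Sum>t\<in>T. G t x) \<partial>M)"
    using G by (simp add: nn_integral_sum)
  also have "\<dots> \<le> (\<integral>\<^sup>+x. (\<Sum>t\<in>T. F t x) \<partial>M)"
    by (intro nn_integral_mono sum_mono G)
  finally show ?thesis .
qed

text \<open>Scaling by c is invertible: a measurable minorant of \<open>c * F\<close> divided by c
  is a minorant of F.\<close>

lemma nn_integral_cmult_le:
  assumes "0 < (c::real)"
  shows "(\<integral>\<^sup>+x. ennreal c * F x \<partial>M) \<le> ennreal c * (\<integral>\<^sup>+x. F x \<partial>M)"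
proof -
  obtain G where G: "G \<in> borel_measurable M" "\<And>x. G x \<le> ennreal c * F x"
    "(\<integral>\<^sup>+x. ennreal c * F x \<partial>M) = (\<integral>\<^sup>+x. G x \<partial>M)"
    using nn_integral_measurable_minorant[of M "\<lambda>x. ennreal c * F x"] by metis
  have inv: "ennreal c * (ennreal (1 / c) * y) = y" "ennreal (1 / c) * (ennreal c * y) = y" for y
    using assms by (simp_all add: mult.assoc[symmetric] ennreal_mult[symmetric])
  have "(\<integral>\<^sup>+x. G x \<partial>M) = ennreal c * (\<integral>\<^sup>+x. ennreal (1 / c) * G x \<partial>M)"
    using G(1) by (subst nn_integral_cmult[symmetric]) (auto simp: inv)
  also have "\<dots> \<le> ennreal c * (\<integral>\<^sup>+x. F x \<partial>M)"
  proof (intro mult_left_mono nn_integral_mono)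
    fix x
    have "ennreal (1 / c) * G x \<le> ennreal (1 / c) * (ennreal c * F x)"
      by (intro mult_left_mono G) auto
    then show "ennreal (1 / c) * G x \<le> F x"
      by (simp add: inv)
  qed auto
  finally show ?thesis using G(3) by simp
qed

section \<open>Elementary properties of Lp\<close>

text \<open>The sum is at most twice the maximum, and the p-th power of the maximum is one of the
  two terms. The constant is not sharp, but no convexity enters.\<close>

lemma powr_sum_le:
  fixes a b p :: real
  assumes "1 \<le> p" "0 \<le> a" "0 \<le> b"
  shows "(a + b) powr p \<le> 2 powr p * (a powr p + b powr p)"
proof -
  have "(a + b) powr p \<le> (2 * max a b) powr p"
    using assms by (intro powr_mono2) auto
  also have "\<dots> = 2 powr p * max a b powr p"
    using assms by (simp add: powr_mult)
  also have "max a b powr p \<le> a powr p + b powr p"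
    by (auto simp: max_def)
  finally show ?thesis by (simp add: mult_left_mono)
qed

lemma abs_add_powr_le:
  fixes a b p :: real
  assumes "1 \<le> p"
  shows "\<bar>a + b\<bar> powr p \<le> 2 powr p * (\<bar>a\<bar> powr p + \<bar>b\<bar> powr p)"
proof -
  have "\<bar>a + b\<bar> powr p \<le> (\<bar>a\<bar> + \<bar>b\<bar>) powr p"
    using assms by (intro powr_mono2) auto
  also have "\<dots> \<le> 2 powr p * (\<bar>a\<bar> powr p + \<bar>b\<bar> powr p)"
    using assms by (intro powr_sum_le) auto
  finally show ?thesis .
qed

text \<open>Young's inequality with the conjugate exponent q = p / (p - 1) cleared away, so that it
  also makes sense for p = 1.\<close>

lemma young_powr:
  fixes a b p :: real
  assumes "1 \<le> p" "0 \<le> a" "0 \<le> b"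
  shows "p * (a * b powr (p - 1)) \<le> a powr p + (p - 1) * b powr p"
proof (cases "p = 1")
  case True
  \<comment> \<open>For p = 1 the factor \<open>b powr 0\<close> is 1 if b > 0, and 0 if b = 0; the
    inequality holds either way.\<close>
  then show ?thesis using assms by (cases "b = 0") auto
next
  case False
  define q where "q = p / (p - 1)"
  have p: "p > 1" using assms False by auto
  have q: "q > 1" "1 / p + 1 / q = 1" "(p - 1) * q = p" "p / q = p - 1"
    using p by (auto simp: q_def field_simps)
  have "a * b powr (p - 1) \<le> a powr p / p + (b powr (p - 1)) powr q / q"
    using p q assms by (intro Youngs_inequality) auto
  also have "(b powr (p - 1)) powr q = b powr p"
    using q by (simp add: powr_powr)
  finally have "p * (a * b powr (p - 1)) \<le> p * (a powr p / p + b powr p / q)"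
    using p by (intro mult_left_mono) auto
  also have "\<dots> = a powr p + (p / q) * b powr p"
    using p by (simp add: field_simps)
  finally show ?thesis using q by simp
qed

lemma Lp_measurable [measurable_dest]: "f \<in> Lp M p \<Longrightarrow> f \<in> borel_measurable M"
  and Lp_integrable: "f \<in> Lp M p \<Longrightarrow> integrable M (\<lambda>x. \<bar>f x\<bar> powr p)"
  by (auto simp: Lp_def)

lemma Lp_add:
  assumes "1 \<le> p" "f \<in> Lp M p" "g \<in> Lp M p"
  shows "(\<lambda>x. f x + g x) \<in> Lp M p"
proof -
  have [measurable]: "f \<in> borel_measurable M" "g \<in> borel_measurable M"
    using assms by (auto simp: Lp_def)
  have "integrable M (\<lambda>x. \<bar>f x + g x\<bar> powr p)"
  proof (rule Bochner_Integration.integrable_bound)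
    show "integrable M (\<lambda>x. 2 powr p * (\<bar>f x\<bar> powr p + \<bar>g x\<bar> powr p))"
      using assms by (intro integrable_mult_right Bochner_Integration.integrable_add Lp_integrable) 
  qed (use abs_add_powr_le[OF assms(1)] in auto)
  then show ?thesis by (auto simp: Lp_def)
qed

lemma Lp_cmult:
  assumes "f \<in> Lp M p"
  shows "(\<lambda>x. c * f x) \<in> Lp M p"
  using assms by (auto simp: Lp_def abs_mult powr_mult)

lemma Lp_diff:
  assumes "1 \<le> p" "f \<in> Lp M p" "g \<in> Lp M p"
  shows "(\<lambda>x. f x - g x) \<in> Lp M p"
  using Lp_add[OF assms(1,2) Lp_cmult[OF assms(3), of "-1"]] by simp

lemma Lp_norm_powr:
  assumes "1 \<le> p"
  shows "Lp_norm M p f powr p = (LINT x|M. \<bar>f x\<bar> powr p)"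
  using assms by (simp add: Lp_norm_def powr_powr)

lemma Lp_strong_convI:
  assumes "1 \<le> p" "\<And>n. fs n \<in> Lp M p" "f \<in> Lp M p"
    and "(\<lambda>n. LINT x|M. \<bar>fs n x - f x\<bar> powr p) \<longlonglongrightarrow> 0"
  shows "Lp_strong_conv M p fs f"
proof -
  have "(\<lambda>n. (LINT x|M. \<bar>fs n x - f x\<bar> powr p) powr (1 / p)) \<longlonglongrightarrow> 0"
    by (rule tendsto_zero_powrI[OF assms(4) tendsto_const]) (use assms(1) in auto)
  then show ?thesis
    using assms by (simp add: Lp_strong_conv_def Lp_norm_def)
qed

section \<open>Dual functionals and weak convergence\<close>

text \<open>The bound on w by \<open>\<bar>h x\<bar> powr (p - 1)\<close> is membership of w in the
  dual Lebesgue space, stated without the dual exponent; for p = 1 it says that w is bounded by 1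
  and vanishes where h does. Young's inequality then does the work of Hoelder's.\<close>

lemma young_integrable:
  assumes "1 \<le> p" "f \<in> Lp M p" "h \<in> Lp M p" "w \<in> borel_measurable M"
    and "\<And>x. \<bar>w x\<bar> \<le> \<bar>h x\<bar> powr (p - 1)"
  shows "integrable M (\<lambda>x. f x * w x)"
    and "p * \<bar>LINT x|M. f x * w x\<bar> \<le>
      (LINT x|M. \<bar>f x\<bar> powr p) + (p - 1) * (LINT x|M. \<bar>h x\<bar> powr p)"
proof -
  have [measurable]: "f \<in> borel_measurable M" "h \<in> borel_measurable M" "w \<in> borel_measurable M"
    using assms by (auto simp: Lp_def)
  let ?b = "\<lambda>x. \<bar>f x\<bar> powr p + (p - 1) * \<bar>h x\<bar> powr p"
  have b: "integrable M ?b"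
    using assms by (intro Bochner_Integration.integrable_add integrable_mult_right Lp_integrable)
  have bnd: "p * \<bar>f x * w x\<bar> \<le> ?b x" for x
  proof -
    have "p * (\<bar>f x\<bar> * \<bar>w x\<bar>) \<le> p * (\<bar>f x\<bar> * \<bar>h x\<bar> powr (p - 1))"
      using assms by (intro mult_left_mono) auto
    also have "\<dots> \<le> ?b x"
      using assms by (intro young_powr) auto
    finally show ?thesis by (simp add: abs_mult)
  qed
  have "\<bar>f x * w x\<bar> \<le> ?b x" for x
  proof -
    have "1 * \<bar>f x * w x\<bar> \<le> p * \<bar>f x * w x\<bar>"
      using assms(1) by (intro mult_right_mono) auto
    with bnd[of x] show ?thesis by simp
  qed
  then show int: "integrable M (\<lambda>x. f x * w x)"
    by (intro Bochner_Integration.integrable_bound[OF b])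
       (auto intro!: AE_I2 order.trans[OF _ abs_ge_self])
  have "p * \<bar>LINT x|M. f x * w x\<bar> \<le> p * (LINT x|M. \<bar>f x * w x\<bar>)"
    using assms(1) by (intro mult_left_mono integral_abs_bound) auto
  also have "\<dots> = (LINT x|M. p * \<bar>f x * w x\<bar>)"
    by simp
  also have "\<dots> \<le> (LINT x|M. ?b x)"
    using int b bnd by (intro integral_mono integrable_mult_right integrable_abs) auto
  also have "\<dots> = (LINT x|M. \<bar>f x\<bar> powr p) + (p - 1) * (LINT x|M. \<bar>h x\<bar> powr p)"
    using assms by (subst Bochner_Integration.integral_add) (auto simp: Lp_integrable)
  finally show "p * \<bar>LINT x|M. f x * w x\<bar> \<le>
      (LINT x|M. \<bar>f x\<bar> powr p) + (p - 1) * (LINT x|M. \<bar>h x\<bar> powr p)" .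
qed

text \<open>Young's inequality is not homogeneous in f, so f is first divided by its norm. A
  function of norm zero vanishes almost everywhere and is treated apart.\<close>

lemma pairing_in_Lp_dual:
  assumes "1 \<le> p" "h \<in> Lp M p" "w \<in> borel_measurable M"
    and "\<And>x. \<bar>w x\<bar> \<le> \<bar>h x\<bar> powr (p - 1)"
  shows "(\<lambda>f. LINT x|M. f x * w x) \<in> Lp_dual M p"
proof -
  note int = young_integrable(1)[OF assms(1) _ assms(2-4)]
  note bnd = young_integrable(2)[OF assms(1) _ assms(2-4)]
  \<comment> \<open>The bound of \<open>young_integrable\<close> for a function of norm one, divided
    by p.\<close>
  define K where "K = (1 + (p - 1) * (LINT x|M. \<bar>h x\<bar> powr p)) / p"
  have "\<bar>LINT x|M. f x * w x\<bar> \<le> K * Lp_norm M p f" if f: "f \<in> Lp M p" for f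
  proof (cases "Lp_norm M p f = 0")
    case True
    have [measurable]: "f \<in> borel_measurable M"
      using f by (auto simp: Lp_def)
    have "(LINT x|M. \<bar>f x\<bar> powr p) = 0"
      using Lp_norm_powr[OF assms(1), of M f] True by simp
    then have "AE x in M. \<bar>f x\<bar> powr p = 0"
      using f by (subst (asm) integral_nonneg_eq_0_iff_AE) (auto simp: Lp_integrable)
    then have "(LINT x|M. f x * w x) = 0"
      by (intro integral_eq_zero_AE) auto
    then show ?thesis using True by simp
  next
    case False
    define N where "N = Lp_norm M p f"
    have N: "N > 0"
      using False by (auto simp: N_def Lp_norm_def)
    have "p * \<bar>LINT x|M. (1 / N * f x) * w x\<bar> \<le>
        (LINT x|M. \<bar>1 / N * f x\<bar> powr p) + (p - 1) * (LINT x|M. \<bar>h x\<bar> powr p)"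
      by (intro bnd Lp_cmult f)
    also have "(LINT x|M. \<bar>1 / N * f x\<bar> powr p) = (LINT x|M. \<bar>f x\<bar> powr p) / N powr p"
      using N by (simp add: abs_mult powr_mult powr_divide)
    also have "\<dots> = 1"
      using N by (simp add: Lp_norm_powr[OF assms(1), of M f, folded N_def, symmetric])
    also have "(LINT x|M. (1 / N * f x) * w x) = (LINT x|M. f x * w x) / N"
      by simp
    finally have "\<bar>LINT x|M. f x * w x\<bar> / N \<le> K"
      using N assms(1) by (simp add: K_def field_simps)
    then show ?thesis
      using N by (simp add: field_simps flip: N_def)
  qed
  then show ?thesis
    by (auto simp: Lp_dual_def distrib_right int mult.assoc)
qed

text \<open>Weak lower semicontinuity of the distance to \<open>u\<close>: test against the functional with density
  \<open>sgn h * \<bar>h\<bar> powr (p - 1)\<close>, where \<open>h = u - f\<close>. The factor \<open>sgn h\<close> also covers \<open>p = 1\<close>, as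
  \<open>0 powr 0 = 0\<close> here.\<close>

lemma weak_limit_Lp_distance_le:
  assumes p: "1 \<le> p" and weak: "Lp_weak_conv M p fs f" and u: "u \<in> Lp M p"
    and freq: "\<exists>\<^sub>F m in sequentially. (LINT x|M. \<bar>u x - fs m x\<bar> powr p) \<le> \<delta>"
  shows "(LINT x|M. \<bar>u x - f x\<bar> powr p) \<le> \<delta>"
proof -
  have Lp: "fs m \<in> Lp M p" "f \<in> Lp M p" for m
    using weak by (auto simp: Lp_weak_conv_def)
  have [measurable]: "u \<in> borel_measurable M" "f \<in> borel_measurable M"
    using u Lp by (auto simp: Lp_def)
  define h where "h x = u x - f x" for x
  define w where "w x = sgn (h x) * \<bar>h x\<bar> powr (p - 1)" for x
  define \<phi> where "\<phi> g = (LINT x|M. g x * w x)" for g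
  define I where "I = (LINT x|M. \<bar>h x\<bar> powr p)"
  have h: "h \<in> Lp M p"
    unfolding h_def by (intro Lp_diff p u Lp)
  have [measurable]: "h \<in> borel_measurable M" by (rule Lp_measurable[OF h])
  have w: "w \<in> borel_measurable M" "\<And>x. \<bar>w x\<bar> \<le> \<bar>h x\<bar> powr (p - 1)"
    unfolding w_def by (measurable, auto simp: abs_mult sgn_if)
  have int: "integrable M (\<lambda>x. g x * w x)" if "g \<in> Lp M p" for g
    by (rule young_integrable(1)[OF p that h w])
  have "\<phi> \<in> Lp_dual M p"
    unfolding \<phi>_def by (rule pairing_in_Lp_dual[OF p h w])
  with weak have "(\<lambda>m. \<phi> (fs m)) \<longlonglongrightarrow> \<phi> f"
    by (auto simp: Lp_weak_conv_def)
  then have lim: "(\<lambda>m. \<phi> u - \<phi> (fs m)) \<longlonglongrightarrow> \<phi> u - \<phi> f"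
    by (intro tendsto_intros)
  have "h x * w x = \<bar>h x\<bar> powr p" for x
  proof (cases "h x = 0")
    case False
    then have "\<bar>h x\<bar> powr 1 * \<bar>h x\<bar> powr (p - 1) = \<bar>h x\<bar> powr p"
      by (simp only: powr_add[symmetric]) simp
    then show ?thesis
      using False by (auto simp: w_def sgn_if abs_if split: if_splits)
  qed (simp add: w_def)
  then have "I = \<phi> h"
    by (simp add: \<phi>_def I_def)
  also have "\<dots> = \<phi> u - \<phi> f"
    using int u Lp by (simp add: \<phi>_def h_def left_diff_distrib)
  finally have I: "\<phi> u - \<phi> f = I" by simp
  have freq': "\<exists>\<^sub>F m in sequentially. p * (\<phi> u - \<phi> (fs m)) \<le> \<delta> + (p - 1) * I"
  proof (rule frequently_elim1[OF freq])
    fix m assume m: "(LINT x|M. \<bar>u x - fs m x\<bar> powr p) \<le> \<delta>"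
    have "\<phi> u - \<phi> (fs m) = (LINT x|M. (u x - fs m x) * w x)"
      using int u Lp by (simp add: \<phi>_def left_diff_distrib)
    then have "p * (\<phi> u - \<phi> (fs m)) \<le> p * \<bar>LINT x|M. (u x - fs m x) * w x\<bar>"
      using p by (intro mult_left_mono) auto
    also have "\<dots> \<le> (LINT x|M. \<bar>u x - fs m x\<bar> powr p) + (p - 1) * I"
      unfolding I_def by (intro young_integrable p Lp_diff u Lp h w)
    finally show "p * (\<phi> u - \<phi> (fs m)) \<le> \<delta> + (p - 1) * I"
      using m by simp
  qed
  \<comment> \<open>The left side of \<open>freq'\<close> tends to \<open>p * I\<close>, so a bound
    that holds infinitely often passes to the limit. Cancelling \<open>(p - 1) * I\<close> leaves
    the claim.\<close>
  have "p * I \<le> \<delta> + (p - 1) * I"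
  proof (rule ccontr)
    assume "\<not> ?thesis"
    moreover have "(\<lambda>m. p * (\<phi> u - \<phi> (fs m))) \<longlonglongrightarrow> p * I"
      using tendsto_mult_left[OF lim] I by simp
    ultimately have "\<forall>\<^sub>F m in sequentially. p * (\<phi> u - \<phi> (fs m)) > \<delta> + (p - 1) * I"
      by (intro order_tendstoD) auto
    with freq' show False
      by (simp add: frequently_def not_le)
  qed
  then show ?thesis
    by (simp add: I_def h_def algebra_simps)
qed

section \<open>Finite measures\<close>

context finite_measure
begin

lemma const_in_Lp: "(\<lambda>x. c) \<in> Lp M p"
  by (simp add: Lp_def)

lemma Lp_imp_integrable:
  assumes "1 \<le> p" "f \<in> Lp M p"
  shows "integrable M f"
  using young_integrable(1)[OF assms const_in_Lp[of 1], of "\<lambda>_. 1"] by simp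

lemma Lp_set_integrable:
  assumes "1 \<le> p" "f \<in> Lp M p" "B \<in> sets M"
  shows "set_integrable M B (\<lambda>x. \<bar>f x\<bar>)" "set_integrable M B (\<lambda>x. \<bar>f x\<bar> powr p)"
  unfolding set_integrable_def
  by (intro integrable_mult_indicator assms integrable_abs Lp_imp_integrable[OF assms(1,2)] Lp_integrable)+

lemma set_integral_real_const:
  assumes "B \<in> sets M"
  shows "set_integrable M B (\<lambda>x. c::real)" "(LINT x:B|M. c) = c * measure M B"
  using assms by (auto simp: set_integrable_def set_lebesgue_integral_def less_top[symmetric])

text \<open>Jensen's inequality from Young's: with b equal to the average a, integrating
  \<open>young_powr\<close> over B gives p m a^p on the left and (p - 1) m a^p beside the integral
  of the p-th power on the right.\<close>

lemma jensen_average_powr: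
  assumes p: "1 \<le> p" and f: "f \<in> Lp M p" and B: "B \<in> sets M" "0 < measure M B"
  shows "((LINT x:B|M. \<bar>f x\<bar>) / measure M B) powr p * measure M B \<le> (LINT x:B|M. \<bar>f x\<bar> powr p)"
proof -
  define m where "m = measure M B"
  define a where "a = (LINT x:B|M. \<bar>f x\<bar>) / m"
  have m: "m > 0" using B by (simp add: m_def)
  have a: "a \<ge> 0"
    using m by (auto simp: a_def set_lebesgue_integral_def intro!: divide_nonneg_pos integral_nonneg_AE)
  note int = Lp_set_integrable[OF p f B(1)]
  note const = set_integral_real_const[OF B(1), folded m_def]
  show ?thesis
  proof (cases "a = 0")
    case True
    have "0 \<le> (LINT x:B|M. \<bar>f x\<bar> powr p)"
      by (auto simp: set_lebesgue_integral_def intro!: integral_nonneg_AE)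
    with True show ?thesis
      by (simp flip: a_def m_def)
  next
    case False
    have "p * (a * m * a powr (p - 1)) = (LINT x:B|M. p * (\<bar>f x\<bar> * a powr (p - 1)))"
      using m by (simp add: a_def)
    also have "\<dots> \<le> (LINT x:B|M. \<bar>f x\<bar> powr p + (p - 1) * a powr p)"
      using p a int const
      by (intro set_integral_mono set_integrable_mult_right set_integral_add(1) set_integrable_mult_left young_powr) auto
    also have "\<dots> = (LINT x:B|M. \<bar>f x\<bar> powr p) + (p - 1) * a powr p * m"
      using int const by (subst set_integral_add(2)) auto
    also have "a * m * a powr (p - 1) = m * (a powr 1 * a powr (p - 1))"
      using a by simp
    also have "\<dots> = m * a powr p"
      by (subst powr_add[symmetric]) simp
    finally show ?thesis
      by (simp add: algebra_simps flip: a_def m_def)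
  qed
qed

lemma set_nn_integral_powr_eq:
  assumes "f \<in> Lp M p" "B \<in> sets M"
  shows "(\<integral>\<^sup>+x\<in>B. ennreal (\<bar>f x\<bar> powr p) \<partial>M) = ennreal (LINT x:B|M. \<bar>f x\<bar> powr p)"
proof -
  have "integrable M (\<lambda>x. indicator B x * \<bar>f x\<bar> powr p)"
    using integrable_mult_indicator[OF assms(2) Lp_integrable[OF assms(1)]] by simp
  then have "(\<integral>\<^sup>+x. ennreal (indicator B x * \<bar>f x\<bar> powr p) \<partial>M) = ennreal (LINT x:B|M. \<bar>f x\<bar> powr p)"
    unfolding set_lebesgue_integral_def by (subst nn_integral_eq_integral) auto
  moreover have "ennreal (\<bar>f x\<bar> powr p) * indicator B x = ennreal (indicator B x * \<bar>f x\<bar> powr p)" for x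
    by (auto simp: indicator_def)
  ultimately show ?thesis by simp
qed

text \<open>The right side has the shape of the integrand in \<open>KS_energy\<close>.\<close>

lemma jensen_average_nn_integral:
  assumes p: "1 \<le> p" and f: "f \<in> Lp M p" and B: "B \<in> sets M" "0 < measure M B"
  shows "ennreal (((LINT x:B|M. \<bar>f x\<bar>) / measure M B) powr p)
    \<le> (\<integral>\<^sup>+x\<in>B. ennreal (\<bar>f x\<bar> powr p) \<partial>M) / emeasure M B"
proof -
  have "ennreal (((LINT x:B|M. \<bar>f x\<bar>) / measure M B) powr p)
      \<le> ennreal ((LINT x:B|M. \<bar>f x\<bar> powr p) / measure M B)"
    using jensen_average_powr[OF assms] B by (intro ennreal_leI) (simp add: field_simps)
  also have "\<dots> = ennreal (LINT x:B|M. \<bar>f x\<bar> powr p) / emeasure M B"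
    unfolding emeasure_eq_measure
    using B by (subst divide_ennreal) (auto simp: set_lebesgue_integral_def intro!: integral_nonneg_AE)
  also have "\<dots> = (\<integral>\<^sup>+x\<in>B. ennreal (\<bar>f x\<bar> powr p) \<partial>M) / emeasure M B"
    using set_nn_integral_powr_eq[OF f B(1)] by simp
  finally show ?thesis .
qed

end

section \<open>Covers with bounded overlap\<close>

text \<open>On a compact space the measure is finite, so doubling can be stated with real numbers; C
  is at least 1 so that its powers bound constants from above.\<close>

locale compact_doubling = finite_measure M
  for M :: "'a::metric_space measure" +
  fixes C :: real
  assumes compact_space: "compact (UNIV :: 'a set)"
    and sets_eq: "sets M = sets borel"
    and C_ge_1: "1 \<le> C"
    and doubling: "0 < r \<Longrightarrow> measure M (ball x (2 * r)) \<le> C * measure M (ball x r)"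
    and ball_pos: "0 < r \<Longrightarrow> 0 < measure M (ball x r)"
begin

lemma ball_sets [measurable, simp]: "ball x r \<in> sets M"
  by (simp add: sets_eq)

lemma continuous_measurable:
  "continuous_on UNIV (f :: 'a \<Rightarrow> real) \<Longrightarrow> f \<in> borel_measurable M"
  by (simp add: borel_measurable_continuous_onI measurable_cong_sets[OF sets_eq])

lemma doubling_iterate:
  assumes "0 < r"
  shows "measure M (ball x (2 ^ k * r)) \<le> C ^ k * measure M (ball x r)"
proof (induction k)
  case (Suc k)
  have "measure M (ball x (2 ^ Suc k * r)) = measure M (ball x (2 * (2 ^ k * r)))"
    by (simp add: mult.assoc)
  also have "\<dots> \<le> C * measure M (ball x (2 ^ k * r))"
    using assms by (intro doubling) auto
  also have "\<dots> \<le> C * (C ^ k * measure M (ball x r))"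
    using Suc C_ge_1 by (intro mult_left_mono) auto
  finally show ?case by (simp add: mult.assoc)
qed simp

text \<open>Finitely many balls of radius R / 2 cover the space, and each contains at most one point
  of an R-separated set. So a separated set of greatest cardinality exists; since no point can be
  added to it, its R-balls cover.\<close>

lemma maximal_separated_set:
  assumes "0 < R"
  obtains T :: "'a set" where "finite T" "\<And>s t. s \<in> T \<Longrightarrow> t \<in> T \<Longrightarrow> s \<noteq> t \<Longrightarrow> R \<le> dist s t"
    "\<And>x. \<exists>t\<in>T. dist t x < R"
proof -
  obtain K :: "'a set" where K: "finite K" "UNIV \<subseteq> (\<Union>k\<in>K. ball k (R / 2))"
    using compact_space assms unfolding compact_eq_totally_bounded by (metis half_gt_zero)
  define sep where "sep T \<longleftrightarrow> finite T \<and> (\<forall>s\<in>T. \<forall>t\<in>T. s \<noteq> t \<longrightarrow> R \<le> dist s t)" for T :: "'a set"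
  have card: "card T \<le> card K" if T: "sep T" for T
  proof -
    have "\<exists>k\<in>K. dist k t < R / 2" for t
      using K(2) by (auto simp: subset_iff)
    then obtain c where c: "\<And>t. c t \<in> K" "\<And>t. dist (c t) t < R / 2" by metis
    have "inj_on c T"
    proof (rule inj_onI, rule ccontr)
      fix s t assume st: "s \<in> T" "t \<in> T" "c s = c t" "s \<noteq> t"
      have "dist s t \<le> dist (c s) s + dist (c s) t"
        by (metis dist_commute dist_triangle)
      also have "\<dots> < R" using c(2)[of s] c(2)[of t] st(3) by simp
      finally show False using T st by (force simp: sep_def)
    qed
    then show ?thesis using c K by (intro card_inj_on_le) auto
  qed
  define n where "n = (GREATEST n. \<exists>T. sep T \<and> card T = n)"
  have "\<exists>T. sep T \<and> card T = n"
    unfolding n_def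
  proof (rule GreatestI_nat)
    show "\<exists>T. sep T \<and> card T = 0"
      by (intro exI[of _ "{}"]) (simp add: sep_def)
  qed (use card in auto)
  then obtain T where T: "sep T" "card T = n" by blast
  have max: "card T' \<le> card T" if "sep T'" for T'
    unfolding T(2) n_def using that card by (intro Greatest_le_nat) auto
  have "\<exists>t\<in>T. dist t x < R" for x
  proof (rule ccontr)
    assume "\<not> ?thesis"
    then have far: "\<forall>t\<in>T. R \<le> dist t x" by auto
    then have "x \<notin> T" using assms by auto
    moreover have "sep (insert x T)"
      using far T(1) by (auto simp: sep_def dist_commute)
    ultimately show False
      using max[of "insert x T"] T(1) by (simp add: sep_def)
  qed
  with T(1) that show thesis by (auto simp: sep_def)
qed

text \<open>Volume packing: the balls of radius R / 2 around the centres near x are disjoint, lie in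
  \<open>ball x (2 * \<Lambda> * R)\<close>, and by doubling each carries at least the fraction 1 /
  C^k of its measure.\<close>

lemma separated_overlap:
  fixes x :: 'a and T :: "'a set"
  assumes "0 < R" "1 \<le> \<Lambda>" "6 * \<Lambda> \<le> 2 ^ k" "finite T"
    and sep: "\<And>s t. s \<in> T \<Longrightarrow> t \<in> T \<Longrightarrow> s \<noteq> t \<Longrightarrow> R \<le> dist s t"
  shows "real (card {t\<in>T. x \<in> ball t (\<Lambda> * R)}) \<le> C ^ k"
proof -
  define T' where "T' = {t\<in>T. x \<in> ball t (\<Lambda> * R)}"
  define D where "D = measure M (ball x (2 * \<Lambda> * R))"
  have LR: "R \<le> \<Lambda> * R" using assms by simp
  have D: "D > 0" unfolding D_def using assms by (intro ball_pos) auto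
  have disj: "disjoint_family_on (\<lambda>t. ball t (R / 2)) T'"
  proof -
    have "ball s (R / 2) \<inter> ball t (R / 2) = {}" if "s \<in> T" "t \<in> T" "s \<noteq> t" for s t
    proof (rule ccontr)
      assume "\<not> ?thesis"
      then obtain z where "dist s z < R / 2" "dist t z < R / 2" by auto
      then have "dist s t < R" using dist_triangle2[of s t z] by simp
      with sep[OF that] show False by simp
    qed
    then show ?thesis by (auto simp: disjoint_family_on_def T'_def)
  qed
  have fin: "finite T'" using assms by (simp add: T'_def)
  have big: "D \<le> C ^ k * measure M (ball t (R / 2))" if "t \<in> T'" for t
  proof -
    have tx: "dist t x < \<Lambda> * R" using that by (simp add: T'_def)
    have le: "6 * (\<Lambda> * R) \<le> 2 ^ k * R"
      using mult_right_mono[OF assms(3), of R] assms(1) by simp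
    \<comment> \<open>The ball around x lies in the ball of radius
      \<open>3 * (\<Lambda> * R)\<close> around t; the assumption on k fits this radius into k
      doublings of R / 2.\<close>
    have "ball x (2 * \<Lambda> * R) \<subseteq> ball t (2 ^ k * (R / 2))"
    proof
      fix z assume "z \<in> ball x (2 * \<Lambda> * R)"
      then have "dist t z < 3 * (\<Lambda> * R)"
        using tx dist_triangle[of t z x] by simp
      also have "\<dots> \<le> 2 ^ k * (R / 2)" using le by simp
      finally show "z \<in> ball t (2 ^ k * (R / 2))" by simp
    qed
    then have "D \<le> measure M (ball t (2 ^ k * (R / 2)))"
      unfolding D_def by (intro finite_measure_mono) auto
    also have "\<dots> \<le> C ^ k * measure M (ball t (R / 2))"
      using assms by (intro doubling_iterate) auto
    finally show ?thesis .
  qed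
  have "real (card T') * D = (\<Sum>t\<in>T'. D)" by simp
  also have "\<dots> \<le> (\<Sum>t\<in>T'. C ^ k * measure M (ball t (R / 2)))"
    by (intro sum_mono big)
  also have "\<dots> = C ^ k * measure M (\<Union>t\<in>T'. ball t (R / 2))"
    using disj fin by (subst finite_measure_finite_Union) (auto simp: sum_distrib_left)
  also have "measure M (\<Union>t\<in>T'. ball t (R / 2)) \<le> D"
    unfolding D_def
  proof (intro finite_measure_mono subsetI)
    fix z assume "z \<in> (\<Union>t\<in>T'. ball t (R / 2))"
    then obtain t where t: "t \<in> T'" "dist t z < R / 2" by auto
    then have "dist x z < \<Lambda> * R + R / 2"
      using dist_triangle[of x z t] by (simp add: T'_def dist_commute)
    then have "dist x z < \<Lambda> * R + \<Lambda> * R" using LR assms(1) by linarith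
    then show "z \<in> ball x (2 * \<Lambda> * R)" by (simp add: algebra_simps)
  qed simp
  finally have "real (card T') * D \<le> C ^ k * D"
    using C_ge_1 by (simp add: mult_left_mono)
  with D show ?thesis by (simp add: T'_def)
qed

text \<open>N is fixed before R: the overlap does not grow as the scale shrinks.\<close>

lemma bounded_overlap_cover:
  assumes "1 \<le> \<Lambda>"
  obtains N :: real where "1 \<le> N"
    "\<And>R. 0 < R \<Longrightarrow> \<exists>T :: 'a set. finite T \<and> (\<Union>t\<in>T. ball t R) = UNIV \<and>
       (\<forall>x. real (card {t\<in>T. x \<in> ball t (\<Lambda> * R)}) \<le> N)"
proof -
  obtain k where k: "6 * \<Lambda> \<le> 2 ^ k"
    using real_arch_pow[of 2 "6 * \<Lambda>"] less_imp_le by auto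
  show thesis
  proof (rule that[of "C ^ k"])
    fix R :: real assume R: "0 < R"
    obtain T :: "'a set" where T: "finite T" "\<And>s t. s \<in> T \<Longrightarrow> t \<in> T \<Longrightarrow> s \<noteq> t \<Longrightarrow> R \<le> dist s t"
      "\<And>x. \<exists>t\<in>T. dist t x < R"
      using maximal_separated_set[OF R] by metis
    show "\<exists>T :: 'a set. finite T \<and> (\<Union>t\<in>T. ball t R) = UNIV \<and>
       (\<forall>x. real (card {t\<in>T. x \<in> ball t (\<Lambda> * R)}) \<le> C ^ k)"
    proof (intro exI[of _ T] conjI allI)
      show "finite T" "(\<Union>t\<in>T. ball t R) = UNIV"
        using T by auto
      show "real (card {t\<in>T. x \<in> ball t (\<Lambda> * R)}) \<le> C ^ k" for x
        by (rule separated_overlap[OF R assms k T(1,2)])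
    qed
  qed (use C_ge_1 in simp)
qed

text \<open>Superadditivity goes in the direction required here, so F may be a function such as
  \<open>Lip\<close> of which no measurability is known.\<close>

lemma sum_set_nn_integral_le:
  assumes "finite T" "1 \<le> N" "\<And>x. real (card {t\<in>T. x \<in> A t}) \<le> N"
  shows "(\<Sum>t\<in>T. \<integral>\<^sup>+x\<in>A t. F x \<partial>M) \<le> ennreal N * (\<integral>\<^sup>+x. F x \<partial>M)"
proof -
  have "(\<Sum>t\<in>T. \<integral>\<^sup>+x\<in>A t. F x \<partial>M) \<le> (\<integral>\<^sup>+x. (\<Sum>t\<in>T. F x * indicator (A t) x) \<partial>M)"
    by (rule nn_integral_superadditive[OF assms(1)])
  also have "\<dots> \<le> (\<integral>\<^sup>+x. ennreal N * F x \<partial>M)"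
  proof (rule nn_integral_mono)
    fix x
    have "(\<Sum>t\<in>T. F x * indicator (A t) x) = F x * (\<Sum>t\<in>T. indicator (A t) x)"
      by (simp add: sum_distrib_left)
    moreover have "(\<Sum>t\<in>T. indicator (A t) x :: ennreal) = of_nat (card {t\<in>T. x \<in> A t})"
      using assms(1) by (simp add: indicator_def sum.If_cases Int_def)
    moreover have "\<dots> \<le> ennreal N"
      using assms(3)[of x] by (simp add: ennreal_of_nat_eq_real_of_nat ennreal_leI)
    ultimately show "(\<Sum>t\<in>T. F x * indicator (A t) x) \<le> ennreal N * F x"
      by (metis mult.commute mult_left_mono zero_le)
  qed
  also have "\<dots> \<le> ennreal N * (\<integral>\<^sup>+x. F x \<partial>M)"
    using assms by (intro nn_integral_cmult_le) auto
  finally show ?thesis .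
qed

end

section \<open>Smoothing by a tent kernel\<close>

text \<open>The support has radius r / 2, so for x' closer than r / 2 to x the kernel at x' still
  vanishes outside \<open>ball x r\<close>. The slope makes the kernel Lipschitz in x.\<close>

definition tent :: "real \<Rightarrow> 'a::metric_space \<Rightarrow> 'a \<Rightarrow> real" where
  "tent r x y = max 0 (1 - 2 * dist x y / r)"

lemma tent_nonneg: "0 \<le> tent r x y"
  and tent_le_1: "0 < r \<Longrightarrow> tent r x y \<le> 1"
  and tent_eq_0: "0 < r \<Longrightarrow> r / 2 \<le> dist x y \<Longrightarrow> tent r x y = 0"
  and tent_ge_half: "0 < r \<Longrightarrow> dist x y < r / 4 \<Longrightarrow> 1 / 2 \<le> tent r x y"
  by (auto simp: tent_def field_simps)

lemma tent_diff_le: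
  assumes "0 < r"
  shows "\<bar>tent r x y - tent r x' y\<bar> \<le> 2 * dist x x' / r"
proof -
  have "\<bar>tent r x y - tent r x' y\<bar> \<le> \<bar>2 * dist x y / r - 2 * dist x' y / r\<bar>"
    by (auto simp: tent_def max_def abs_if)
  also have "2 * dist x y / r - 2 * dist x' y / r = 2 / r * (dist x y - dist x' y)"
    by (simp add: algebra_simps)
  also have "\<bar>2 / r * (dist x y - dist x' y)\<bar> = 2 * \<bar>dist x y - dist x' y\<bar> / r"
    using assms by (subst abs_mult) simp
  also have "\<dots> \<le> 2 * dist x x' / r"
    using assms abs_dist_diff_le[of x y x']
    by (intro divide_right_mono mult_left_mono) (auto simp: dist_commute)
  finally show ?thesis .
qed

text \<open>\<open>Lip\<close> compares values only with the one at the fixed centre x, and only at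
  small radii. So a bound on one small ball around x suffices, and L may vary with x.\<close>

lemma Lip_le:
  assumes "0 < \<rho>" "0 \<le> L" "\<And>x'. dist x x' < \<rho> \<Longrightarrow> \<bar>f x' - f x\<bar> \<le> L * dist x x'"
  shows "Lip f x \<le> ennreal L"
  unfolding Lip_def
proof (rule Limsup_bounded)
  show "\<forall>\<^sub>F r in at_right 0. (SUP x'\<in>cball x r. ennreal (\<bar>f x' - f x\<bar> / r)) \<le> ennreal L"
    unfolding eventually_at_right_field
  proof (intro exI[of _ \<rho>] conjI allI impI SUP_least ennreal_leI)
    fix r x' assume r: "0 < r" "r < \<rho>" and x': "x' \<in> cball x r"
    then have "\<bar>f x' - f x\<bar> \<le> L * dist x x'"
      by (intro assms) auto
    also have "\<dots> \<le> L * r"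
      using x' assms by (intro mult_left_mono) auto
    finally show "\<bar>f x' - f x\<bar> / r \<le> L"
      using r by (simp add: field_simps)
  qed (use assms in auto)
qed

context compact_doubling
begin

definition tent_mass :: "real \<Rightarrow> 'a \<Rightarrow> real" where
  "tent_mass r x = (LINT y|M. tent r x y)"

definition smoothing :: "real \<Rightarrow> ('a \<Rightarrow> real) \<Rightarrow> 'a \<Rightarrow> real" where
  "smoothing r f x = (LINT y|M. tent r x y * f y) / tent_mass r x"

text \<open>The first power is what bounds the smoothing error and \<open>Lip\<close> pointwise;
  Jensen's inequality turns it into the integrand of \<open>KS_energy\<close>.\<close>

definition oscillation :: "real \<Rightarrow> ('a \<Rightarrow> real) \<Rightarrow> 'a \<Rightarrow> real" where
  "oscillation r f x = (LINT y:ball x r|M. \<bar>f y - f x\<bar>) / measure M (ball x r)"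

text \<open>\<open>K / measure M (ball x r)\<close> bounds the normalised kernel \<open>tent r x' y / tent_mass r x'\<close>
  for all \<open>x'\<close> within distance \<open>r / 2\<close> of \<open>x\<close>.\<close>

definition K :: real where
  "K = 2 * C ^ 3"

lemma K_ge_1: "1 \<le> K"
proof -
  have "1 \<le> C ^ 3" using C_ge_1 by (rule one_le_power)
  then show ?thesis by (simp add: K_def)
qed

lemma tent_measurable [measurable]: "tent r x \<in> borel_measurable M"
proof -
  have "tent r x = (\<lambda>y. max 0 (1 - dist x y * (2 / r)))"
    by (auto simp: tent_def fun_eq_iff mult.commute)
  moreover have "continuous_on UNIV \<dots>"
    by (intro continuous_on_max continuous_on_diff continuous_on_mult continuous_on_dist
        continuous_on_const continuous_on_id)
  ultimately show ?thesis by (simp add: continuous_measurable)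
qed

lemma tent_integrable:
  assumes "0 < r" "integrable M f"
  shows "integrable M (\<lambda>y. tent r x y * f y)" "integrable M (tent r x)"
proof -
  have *: "integrable M (\<lambda>y. tent r x y * g y)" if "integrable M g" for g
  proof (rule Bochner_Integration.integrable_bound[OF that])
    have [measurable]: "g \<in> borel_measurable M" using that by auto
    show "(\<lambda>y. tent r x y * g y) \<in> borel_measurable M" by measurable
    show "AE y in M. norm (tent r x y * g y) \<le> norm (g y)"
      using tent_nonneg[of r x] tent_le_1[OF assms(1), of x]
      by (auto simp: abs_mult intro!: AE_I2 mult_left_le_one_le)
  qed
  show "integrable M (\<lambda>y. tent r x y * f y)" by (rule *[OF assms(2)])
  show "integrable M (tent r x)" using *[of "\<lambda>_. 1"] by simp
qed

text \<open>\<open>ball x r\<close> lies in \<open>ball x' (2 * r)\<close>, three doublings above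
  \<open>ball x' (r / 4)\<close>, where the tent is at least 1 / 2. This gives
  \<open>K = 2 * C ^ 3\<close>.\<close>

lemma ball_le_tent_mass:
  assumes "0 < r" "dist x x' < r / 2"
  shows "measure M (ball x r) \<le> K * tent_mass r x'"
proof -
  have "ball x r \<subseteq> ball x' (2 * r)"
  proof
    fix y assume "y \<in> ball x r"
    then show "y \<in> ball x' (2 * r)"
      using assms dist_triangle[of x' y x] by (simp add: dist_commute)
  qed
  then have "measure M (ball x r) \<le> measure M (ball x' (2 * r))"
    by (intro finite_measure_mono) auto
  also have "\<dots> = measure M (ball x' (2 ^ 3 * (r / 4)))"
    by simp
  also have "\<dots> \<le> C ^ 3 * measure M (ball x' (r / 4))"
    using assms by (intro doubling_iterate) auto
  also have "\<dots> = K * (LINT y|M. 1 / 2 * indicator (ball x' (r / 4)) y)"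
    by (simp add: K_def)
  also have "\<dots> \<le> K * tent_mass r x'"
    unfolding tent_mass_def
  proof (intro mult_left_mono integral_mono)
    show "1 / 2 * indicator (ball x' (r / 4)) y \<le> tent r x' y" for y
      using tent_nonneg[of r x' y] tent_ge_half[OF assms(1), of x' y] by (auto simp: indicator_def)
    show "integrable M (tent r x')"
      by (rule tent_integrable(2)[OF assms(1), of "\<lambda>_. 0"]) simp
    show "integrable M (\<lambda>y. 1 / 2 * indicator (ball x' (r / 4)) y :: real)"
      by (intro integrable_mult_right integrable_real_indicator) (auto simp: less_top[symmetric])
  qed (use K_ge_1 in simp)
  finally show ?thesis .
qed

lemma tent_mass_pos:
  assumes "0 < r"
  shows "0 < tent_mass r x"
proof -
  have "0 < K * tent_mass r x"
    using ball_le_tent_mass[OF assms, of x x] ball_pos[OF assms, of x] assms by simp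
  then show ?thesis using K_ge_1 by (simp add: zero_less_mult_iff)
qed

lemma inverse_tent_mass_le:
  assumes "0 < r" "dist x x' < r / 2"
  shows "1 / tent_mass r x' \<le> K / measure M (ball x r)"
  using ball_le_tent_mass[OF assms] tent_mass_pos[OF assms(1), of x'] ball_pos[OF assms(1), of x]
  by (simp add: field_simps)

lemma smoothing_diff_const:
  assumes "0 < r" "integrable M f"
  shows "smoothing r f x - c = (LINT y|M. tent r x y * (f y - c)) / tent_mass r x"
proof -
  have "(LINT y|M. tent r x y * (f y - c)) = (LINT y|M. tent r x y * f y - c * tent r x y)"
    by (intro Bochner_Integration.integral_cong) (auto simp: algebra_simps)
  also have "\<dots> = (LINT y|M. tent r x y * f y) - c * tent_mass r x"
    using tent_integrable[OF assms] by (simp add: tent_mass_def)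
  finally show ?thesis
    using tent_mass_pos[OF assms(1), of x] by (simp add: smoothing_def field_simps)
qed

lemma abs_integral_le_ball:
  fixes f :: "'a \<Rightarrow> real"
  assumes f: "integrable M f" and w: "w \<in> borel_measurable M" "0 \<le> b" "\<And>y. \<bar>w y\<bar> \<le> b"
    "\<And>y. r \<le> dist x y \<Longrightarrow> w y = 0"
  shows "\<bar>LINT y|M. w y * f y\<bar> \<le> b * (LINT y:ball x r|M. \<bar>f y\<bar>)"
proof -
  have [measurable]: "f \<in> borel_measurable M" "w \<in> borel_measurable M"
    using f w by auto
  have bnd: "\<bar>w y * f y\<bar> \<le> b * (indicator (ball x r) y * \<bar>f y\<bar>)" for y
    using w(3)[of y] w(4)[of y] by (auto simp: indicator_def abs_mult not_less intro: mult_right_mono)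
  have int: "integrable M (\<lambda>y. b * (indicator (ball x r) y * \<bar>f y\<bar>))"
    using integrable_mult_indicator[OF ball_sets[of x r] integrable_abs[OF f]] by simp
  have int': "integrable M (\<lambda>y. \<bar>w y * f y\<bar>)"
    using bnd by (intro Bochner_Integration.integrable_bound[OF int])
      (auto intro!: order.trans[OF _ abs_ge_self])
  have "\<bar>LINT y|M. w y * f y\<bar> \<le> (LINT y|M. \<bar>w y * f y\<bar>)"
    by (rule integral_abs_bound)
  also have "\<dots> \<le> (LINT y|M. b * (indicator (ball x r) y * \<bar>f y\<bar>))"
    by (intro integral_mono int int' bnd)
  finally show ?thesis by (simp add: set_lebesgue_integral_def)
qed

text \<open>The free constant c serves several purposes: x' = x and c = f x give the smoothing
  error, c = 0 gives a bound on the smoothing itself.\<close>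

lemma smoothing_diff_const_le:
  assumes r: "0 < r" and f: "integrable M f" and d: "dist x x' < r / 2"
  shows "\<bar>smoothing r f x' - c\<bar> \<le> K / measure M (ball x r) * (LINT y:ball x r|M. \<bar>f y - c\<bar>)"
proof -
  have fc: "integrable M (\<lambda>y. f y - c)" using f by auto
  have zero: "tent r x' y = 0" if "r \<le> dist x y" for y
    using that d dist_triangle[of x y x'] by (intro tent_eq_0 r) auto
  have "\<bar>smoothing r f x' - c\<bar> = \<bar>LINT y|M. tent r x' y * (f y - c)\<bar> * (1 / tent_mass r x')"
    using tent_mass_pos[OF r, of x'] by (simp add: smoothing_diff_const[OF r f] abs_divide)
  also have "\<dots> \<le> (1 * (LINT y:ball x r|M. \<bar>f y - c\<bar>)) * (K / measure M (ball x r))"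
    using tent_nonneg[of r x'] tent_le_1[OF r, of x'] zero tent_mass_pos[OF r, of x']
    by (intro mult_mono abs_integral_le_ball fc tent_measurable inverse_tent_mass_le r d)
       (auto simp: set_lebesgue_integral_def intro!: integral_nonneg_AE)
  finally show ?thesis by (simp add: mult.commute)
qed

text \<open>The difference of two normalised kernels is avoided by centring \<open>f\<close> at \<open>smoothing r f x'\<close>,
  which makes its integral against the kernel at \<open>x'\<close> vanish.\<close>

lemma smoothing_diff_le:
  assumes r: "0 < r" and f: "integrable M f" and d: "dist x x' < r / 2"
  shows "\<bar>smoothing r f x' - smoothing r f x\<bar>
    \<le> 2 * K * (1 + K) / r * ((LINT y:ball x r|M. \<bar>f y - c\<bar>) / measure M (ball x r)) * dist x x'"
proof -
  define V where "V = measure M (ball x r)"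
  define I where "I = (LINT y:ball x r|M. \<bar>f y - c\<bar>)"
  define a where "a = smoothing r f x'"
  have V: "V > 0" unfolding V_def by (rule ball_pos[OF r])
  have fa: "integrable M (\<lambda>y. f y - b)" for b using f by auto
  have set_int: "set_integrable M (ball x r) (\<lambda>y. \<bar>f y - b\<bar>)" for b
    unfolding set_integrable_def by (intro integrable_mult_indicator integrable_abs fa) auto
  note const = set_integral_real_const[OF ball_sets[of x r], folded V_def]
  have zero: "tent r x y - tent r x' y = 0" if "r \<le> dist x y" for y
    using that d r dist_triangle[of x y x'] by (subst (1 2) tent_eq_0) auto
  have "(LINT y|M. tent r x' y * (f y - a)) / tent_mass r x' = 0"
    by (simp add: smoothing_diff_const[OF r f, symmetric] a_def)
  then have "(LINT y|M. tent r x' y * (f y - a)) = 0"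
    using tent_mass_pos[OF r, of x'] by simp
  then have "smoothing r f x - a
      = (LINT y|M. (tent r x y - tent r x' y) * (f y - a)) / tent_mass r x"
    using tent_integrable(1)[OF r fa]
    by (simp add: smoothing_diff_const[OF r f] left_diff_distrib)
  then have "\<bar>smoothing r f x - a\<bar>
      = \<bar>LINT y|M. (tent r x y - tent r x' y) * (f y - a)\<bar> * (1 / tent_mass r x)"
    using tent_mass_pos[OF r, of x] by (simp add: abs_divide)
  also have "\<dots> \<le> (2 * dist x x' / r * (LINT y:ball x r|M. \<bar>f y - a\<bar>)) * (K / V)"
    unfolding V_def
    using tent_mass_pos[OF r, of x] r zero
    by (intro mult_mono abs_integral_le_ball fa inverse_tent_mass_le tent_diff_le borel_measurable_diff tent_measurable)
       (auto simp: set_lebesgue_integral_def intro!: integral_nonneg_AE)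
  also have "\<dots> \<le> (2 * dist x x' / r * ((1 + K) * I)) * (K / V)"
  proof (intro mult_right_mono mult_left_mono)
    \<comment> \<open>Changing the centre from a to c costs \<open>\<bar>c - a\<bar> * V\<close>,
      and \<open>smoothing_diff_const_le\<close> bounds this by K * I; hence the factor 1 +
      K.\<close>
    have "(LINT y:ball x r|M. \<bar>f y - a\<bar>) \<le> (LINT y:ball x r|M. \<bar>f y - c\<bar> + \<bar>c - a\<bar>)"
      by (intro set_integral_mono set_integral_add(1) set_int const) auto
    also have "\<dots> = I + \<bar>c - a\<bar> * V"
      by (subst set_integral_add(2)) (auto simp: set_int const I_def)
    also have "\<bar>c - a\<bar> * V \<le> (K / V * I) * V"
      using smoothing_diff_const_le[OF r f d, of c] V
      by (intro mult_right_mono) (auto simp: a_def V_def I_def abs_minus_commute)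
    finally show "(LINT y:ball x r|M. \<bar>f y - a\<bar>) \<le> (1 + K) * I"
      using V by (simp add: algebra_simps)
  qed (use V r K_ge_1 in auto)
  finally show ?thesis
    by (simp add: a_def V_def I_def abs_minus_commute algebra_simps add_divide_distrib)
qed

lemma oscillation_nonneg: "0 \<le> oscillation r f x"
  unfolding oscillation_def set_lebesgue_integral_def
  by (intro divide_nonneg_nonneg integral_nonneg_AE) auto

lemma smoothing_error_le:
  assumes "0 < r" "integrable M f"
  shows "\<bar>smoothing r f x - f x\<bar> \<le> K * oscillation r f x"
  using smoothing_diff_const_le[OF assms, of x x "f x"] assms by (simp add: oscillation_def)

text \<open>The choice c = f x in \<open>smoothing_diff_le\<close> gives a Lipschitz bound at x by
  the oscillation at the same point x.\<close>

lemma Lip_smoothing_le: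
  assumes "0 < r" "integrable M f"
  shows "Lip (smoothing r f) x \<le> ennreal (2 * K * (1 + K) / r * oscillation r f x)"
proof (rule Lip_le)
  show "0 \<le> 2 * K * (1 + K) / r * oscillation r f x"
    using assms K_ge_1 oscillation_nonneg[of r f x] by simp
  show "\<bar>smoothing r f x' - smoothing r f x\<bar> \<le> 2 * K * (1 + K) / r * oscillation r f x * dist x x'"
    if "dist x x' < r / 2" for x'
    unfolding oscillation_def by (rule smoothing_diff_le[OF assms that])
qed (use assms in simp)

text \<open>The diameter is finite, so k doublings of any r-ball, with k independent of the centre,
  exhaust the space.\<close>

lemma ball_measure_lower_bound:
  assumes "0 < r"
  obtains m where "0 < m" "\<And>x. m \<le> measure M (ball x r)"
proof -
  obtain e where e: "\<And>x y :: 'a. dist x y \<le> e"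
    using compact_imp_bounded[OF compact_space] by (auto simp: bounded_two_points)
  obtain k where "e / r < 2 ^ k"
    using real_arch_pow[of 2 "e / r"] by auto
  then have k: "e < 2 ^ k * r" using assms by (simp add: field_simps)
  have all: "ball x (2 ^ k * r) = UNIV" for x :: 'a
    using k by (auto intro: le_less_trans[OF e])
  show thesis
  proof
    show "0 < measure M UNIV / C ^ k"
      using ball_pos[of "2 ^ k * r" undefined] assms C_ge_1 by (simp add: all)
    show "measure M UNIV / C ^ k \<le> measure M (ball x r)" for x
      using doubling_iterate[OF assms, of x k, unfolded all] C_ge_1 by (simp add: field_simps)
  qed
qed

text \<open>This makes the smoothing admissible in the Poincare inequality; the constant may depend
  on r and f. Points closer than r / 2 are covered by \<open>smoothing_diff_le\<close> with c = 0.
  For the others boundedness by G suffices, as 2 G is at most 4 G / r times their distance.\<close>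

lemma smoothing_lipschitz:
  assumes r: "0 < r" and f: "integrable M f"
  shows "\<exists>L. L-lipschitz_on UNIV (smoothing r f)"
proof -
  obtain m where m: "0 < m" "\<And>x. m \<le> measure M (ball x r)"
    using ball_measure_lower_bound[OF r] by blast
  define F where "F = (LINT y|M. \<bar>f y\<bar>)"
  define G where "G = K / m * F"
  have G: "0 \<le> G"
    using K_ge_1 m by (auto simp: G_def F_def intro!: mult_nonneg_nonneg integral_nonneg_AE)
  have avg: "(LINT y:ball x r|M. \<bar>f y - 0\<bar>) / measure M (ball x r) \<le> F / m" for x
  proof (rule frac_le)
    have "(LINT y:ball x r|M. \<bar>f y\<bar>) \<le> F"
      unfolding set_lebesgue_integral_def F_def
      by (intro integral_mono integrable_mult_indicator integrable_abs f) (auto simp: indicator_def)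
    then show "(LINT y:ball x r|M. \<bar>f y - 0\<bar>) \<le> F" by simp
  qed (use m in \<open>auto simp: F_def intro!: integral_nonneg_AE\<close>)
  have bound: "\<bar>smoothing r f x\<bar> \<le> G" for x
  proof -
    have "\<bar>smoothing r f x - 0\<bar> \<le> K * ((LINT y:ball x r|M. \<bar>f y - 0\<bar>) / measure M (ball x r))"
      using smoothing_diff_const_le[OF r f, of x x 0] r by simp
    also have "\<dots> \<le> K * (F / m)"
      using K_ge_1 by (intro mult_left_mono avg) auto
    finally show ?thesis by (simp add: G_def)
  qed
  define L where "L = 2 * K * (1 + K) / r * (F / m) + 4 * G / r"
  have L: "0 \<le> 2 * K * (1 + K) / r * (F / m)" "0 \<le> 4 * G / r"
    using K_ge_1 r m G by (auto simp: F_def intro!: mult_nonneg_nonneg divide_nonneg_nonneg integral_nonneg_AE)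
  have lip: "\<bar>smoothing r f x' - smoothing r f x\<bar> \<le> L * dist x x'" for x x'
  proof (cases "dist x x' < r / 2")
    case True
    have "\<bar>smoothing r f x' - smoothing r f x\<bar> \<le> 2 * K * (1 + K) / r *
        ((LINT y:ball x r|M. \<bar>f y - 0\<bar>) / measure M (ball x r)) * dist x x'"
      by (rule smoothing_diff_le[OF r f True])
    also have "\<dots> \<le> 2 * K * (1 + K) / r * (F / m) * dist x x'"
      using K_ge_1 r by (intro mult_right_mono mult_left_mono avg) auto
    also have "\<dots> \<le> L * dist x x'"
      using L by (intro mult_right_mono) (auto simp: L_def)
    finally show ?thesis .
  next
    case False
    have "\<bar>smoothing r f x' - smoothing r f x\<bar> \<le> 2 * G"
      using bound[of x] bound[of x'] by linarith
    also have "\<dots> = 4 * G / r * (r / 2)"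
      using r by simp
    also have "\<dots> \<le> 4 * G / r * dist x x'"
      using False L by (intro mult_left_mono) auto
    also have "\<dots> \<le> L * dist x x'"
      using L by (intro mult_right_mono) (auto simp: L_def)
    finally show ?thesis .
  qed
  have "L-lipschitz_on UNIV (smoothing r f)"
  proof (rule lipschitz_onI)
    show "dist (smoothing r f x) (smoothing r f y) \<le> L * dist x y" for x y
      using lip[of y x] by (simp add: dist_real_def abs_minus_commute)
    show "0 \<le> L" using L by (simp only: L_def add_nonneg_nonneg)
  qed
  then show ?thesis by blast
qed

section \<open>Bounds for the smoothing by the energy\<close>

lemma oscillation_energy_le:
  assumes "1 \<le> p" "f \<in> Lp M p" "0 < r"
  shows "(\<integral>\<^sup>+x. ennreal (oscillation r f x powr p) \<partial>M) \<le> ennreal (r powr p) * KS_energy M p r f"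
proof -
  let ?I = "\<integral>\<^sup>+x. (\<integral>\<^sup>+y\<in>ball x r. ennreal (\<bar>f y - f x\<bar> powr p) \<partial>M) / emeasure M (ball x r) \<partial>M"
  \<comment> \<open>Jensen's inequality on each ball; the outer integral only has to be monotone,
    which holds without measurability.\<close>
  have "(\<integral>\<^sup>+x. ennreal (oscillation r f x powr p) \<partial>M) \<le> ?I"
    unfolding oscillation_def
    using assms by (intro nn_integral_mono jensen_average_nn_integral Lp_diff const_in_Lp ball_pos) auto
  also have "?I = ennreal (r powr p) * KS_energy M p r f"
    using assms(3) mult_divide_eq_ennreal[of "ennreal (r powr p)" ?I]
    by (simp add: KS_energy_def ennreal_times_divide mult.commute[of "ennreal (r powr p)"])
  finally show ?thesis .
qed

text \<open>The factor \<open>r powr p\<close> makes the error small when the energy is bounded and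
  r is small.\<close>

lemma smoothing_error_energy_le:
  assumes "1 \<le> p" "f \<in> Lp M p" "0 < r"
  shows "(\<integral>\<^sup>+x. ennreal (\<bar>smoothing r f x - f x\<bar> powr p) \<partial>M)
    \<le> ennreal (K powr p * r powr p) * KS_energy M p r f"
proof -
  have f: "integrable M f" by (rule Lp_imp_integrable[OF assms(1,2)])
  have "(\<integral>\<^sup>+x. ennreal (\<bar>smoothing r f x - f x\<bar> powr p) \<partial>M)
      \<le> (\<integral>\<^sup>+x. ennreal (K powr p) * ennreal (oscillation r f x powr p) \<partial>M)"
  proof (rule nn_integral_mono)
    fix x
    have "\<bar>smoothing r f x - f x\<bar> powr p \<le> (K * oscillation r f x) powr p"
      using assms smoothing_error_le[OF assms(3) f, of x] by (intro powr_mono2) auto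
    also have "\<dots> = K powr p * oscillation r f x powr p"
      using K_ge_1 oscillation_nonneg by (simp add: powr_mult)
    finally show "ennreal (\<bar>smoothing r f x - f x\<bar> powr p)
        \<le> ennreal (K powr p) * ennreal (oscillation r f x powr p)"
      by (simp add: ennreal_mult[symmetric] ennreal_leI)
  qed
  also have "\<dots> \<le> ennreal (K powr p) * (\<integral>\<^sup>+x. ennreal (oscillation r f x powr p) \<partial>M)"
    using K_ge_1 by (intro nn_integral_cmult_le) auto
  also have "\<dots> \<le> ennreal (K powr p) * (ennreal (r powr p) * KS_energy M p r f)"
    by (intro mult_left_mono oscillation_energy_le assms) auto
  finally show ?thesis by (simp add: ennreal_mult mult.assoc)
qed

text \<open>The factor 1 / r in \<open>Lip_smoothing_le\<close> cancels the \<open>r powr p\<close>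
  of \<open>oscillation_energy_le\<close>, so the bound is uniform in r.\<close>

lemma Lip_smoothing_energy_le:
  assumes "1 \<le> p" "f \<in> Lp M p" "0 < r"
  shows "(\<integral>\<^sup>+x. ennreal (enn2real (Lip (smoothing r f) x) powr p) \<partial>M)
    \<le> ennreal ((2 * K * (1 + K)) powr p) * KS_energy M p r f"
proof -
  have f: "integrable M f" by (rule Lp_imp_integrable[OF assms(1,2)])
  define k where "k = (2 * K * (1 + K) / r) powr p"
  have k0: "0 < k" using K_ge_1 assms(3) by (simp add: k_def)
  have "(\<integral>\<^sup>+x. ennreal (enn2real (Lip (smoothing r f) x) powr p) \<partial>M)
      \<le> (\<integral>\<^sup>+x. ennreal k * ennreal (oscillation r f x powr p) \<partial>M)"
  proof (rule nn_integral_mono)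
    fix x
    have nn: "0 \<le> 2 * K * (1 + K) / r * oscillation r f x"
      using assms(3) K_ge_1 oscillation_nonneg[of r f x] by simp
    have "enn2real (Lip (smoothing r f) x) \<le> 2 * K * (1 + K) / r * oscillation r f x"
      using Lip_smoothing_le[OF assms(3) f, of x] nn by (intro enn2real_leI) auto
    then have "enn2real (Lip (smoothing r f) x) powr p
        \<le> (2 * K * (1 + K) / r * oscillation r f x) powr p"
      using assms by (intro powr_mono2) auto
    also have "\<dots> = k * oscillation r f x powr p"
      unfolding k_def by (rule powr_mult)
    finally show "ennreal (enn2real (Lip (smoothing r f) x) powr p)
        \<le> ennreal k * ennreal (oscillation r f x powr p)"
      using k0 by (simp add: ennreal_mult[symmetric] ennreal_leI)
  qed
  also have "\<dots> \<le> ennreal k * (\<integral>\<^sup>+x. ennreal (oscillation r f x powr p) \<partial>M)"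
    by (rule nn_integral_cmult_le[OF k0])
  also have "\<dots> \<le> ennreal k * (ennreal (r powr p) * KS_energy M p r f)"
    by (intro mult_left_mono oscillation_energy_le assms) auto
  also have "\<dots> = ennreal (k * r powr p) * KS_energy M p r f"
    using k0 by (simp add: ennreal_mult mult.assoc)
  also have "k * r powr p = (2 * K * (1 + K)) powr p"
    using assms(3) K_ge_1 by (simp add: k_def powr_divide)
  finally show ?thesis .
qed

end

section \<open>Oscillation on the balls of a cover\<close>

lemma set_nn_integral_abs_add_powr_le:
  fixes u v :: "'a \<Rightarrow> real"
  assumes "1 \<le> p" and [measurable]: "u \<in> borel_measurable M" "v \<in> borel_measurable M" "B \<in> sets M"
  shows "(\<integral>\<^sup>+x\<in>B. ennreal (\<bar>u x + v x\<bar> powr p) \<partial>M) \<le> ennreal (2 powr p) *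
    ((\<integral>\<^sup>+x\<in>B. ennreal (\<bar>u x\<bar> powr p) \<partial>M) + (\<integral>\<^sup>+x\<in>B. ennreal (\<bar>v x\<bar> powr p) \<partial>M))"
proof -
  have "(\<integral>\<^sup>+x\<in>B. ennreal (\<bar>u x + v x\<bar> powr p) \<partial>M)
      \<le> (\<integral>\<^sup>+x. ennreal (2 powr p) * (ennreal (\<bar>u x\<bar> powr p) * indicator B x
            + ennreal (\<bar>v x\<bar> powr p) * indicator B x) \<partial>M)"
  proof (rule nn_integral_mono)
    fix x
    have "ennreal (\<bar>u x + v x\<bar> powr p) \<le> ennreal (2 powr p * (\<bar>u x\<bar> powr p + \<bar>v x\<bar> powr p))"
      by (intro ennreal_leI abs_add_powr_le assms)
    then show "ennreal (\<bar>u x + v x\<bar> powr p) * indicator B x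
      \<le> ennreal (2 powr p) * (ennreal (\<bar>u x\<bar> powr p) * indicator B x
            + ennreal (\<bar>v x\<bar> powr p) * indicator B x)"
      by (auto simp: indicator_def ennreal_mult)
  qed
  also have "\<dots> = ennreal (2 powr p) *
    ((\<integral>\<^sup>+x\<in>B. ennreal (\<bar>u x\<bar> powr p) \<partial>M) + (\<integral>\<^sup>+x\<in>B. ennreal (\<bar>v x\<bar> powr p) \<partial>M))"
    by (simp add: nn_integral_cmult nn_integral_add)
  finally show ?thesis .
qed

context compact_doubling
begin

lemma set_nn_integral_const_ball:
  assumes "0 \<le> c"
  shows "(\<integral>\<^sup>+x\<in>ball t R. ennreal c \<partial>M) = ennreal (c * measure M (ball t R))"
  using assms by (simp add: nn_integral_cmult_indicator emeasure_eq_measure ennreal_mult)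

lemma ball_average_diff_powr_le:
  assumes "1 \<le> p" "f \<in> Lp M p" "0 < R"
  shows "ennreal (\<bar>ball_average M t R f - a\<bar> powr p * measure M (ball t R))
    \<le> (\<integral>\<^sup>+x\<in>ball t R. ennreal (\<bar>f x - a\<bar> powr p) \<partial>M)"
proof -
  define V where "V = measure M (ball t R)"
  have V: "V > 0" unfolding V_def by (rule ball_pos[OF assms(3)])
  have fa: "(\<lambda>x. f x - a) \<in> Lp M p"
    by (intro Lp_diff const_in_Lp assms)
  have f: "integrable M f" by (rule Lp_imp_integrable[OF assms(1,2)])
  have int: "set_integrable M (ball t R) f"
    unfolding set_integrable_def by (intro integrable_mult_indicator f) auto
  note const = set_integral_real_const[OF ball_sets[of t R], folded V_def]
  have "ball_average M t R f - a = (LINT x:ball t R|M. f x - a) / V"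
    using int const V by (simp add: ball_average_def V_def[symmetric] field_simps)
  also have "\<bar>\<dots>\<bar> \<le> (LINT x:ball t R|M. \<bar>f x - a\<bar>) / V"
  proof -
    have "\<bar>LINT x:ball t R|M. f x - a\<bar> \<le> (LINT x|M. \<bar>indicator (ball t R) x *\<^sub>R (f x - a)\<bar>)"
      unfolding set_lebesgue_integral_def by (rule integral_abs_bound)
    also have "\<dots> = (LINT x:ball t R|M. \<bar>f x - a\<bar>)"
      by (simp add: set_lebesgue_integral_def abs_mult)
    finally show ?thesis using V by (simp add: abs_divide divide_right_mono)
  qed
  finally have "\<bar>ball_average M t R f - a\<bar> powr p * V
      \<le> ((LINT x:ball t R|M. \<bar>f x - a\<bar>) / V) powr p * V"
    using V assms by (intro mult_right_mono powr_mono2) auto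
  also have "\<dots> \<le> (LINT x:ball t R|M. \<bar>f x - a\<bar> powr p)"
    unfolding V_def by (intro jensen_average_powr assms fa ball_pos) simp
  finally show ?thesis
    by (simp add: set_nn_integral_powr_eq[OF fa] V_def ennreal_leI)
qed

text \<open>Up to a constant factor no a does better than the average. This lets the average of f
  replace that of its smoothing, which is the one the Poincare inequality provides.\<close>

lemma ball_average_nearly_optimal:
  assumes "1 \<le> p" "f \<in> Lp M p" "0 < R"
  shows "(\<integral>\<^sup>+x\<in>ball t R. ennreal (\<bar>f x - ball_average M t R f\<bar> powr p) \<partial>M)
    \<le> ennreal (2 powr p * 2) * (\<integral>\<^sup>+x\<in>ball t R. ennreal (\<bar>f x - a\<bar> powr p) \<partial>M)"
proof -
  have [measurable]: "f \<in> borel_measurable M"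
    by (rule Lp_measurable[OF assms(2)])
  let ?I = "\<integral>\<^sup>+x\<in>ball t R. ennreal (\<bar>f x - a\<bar> powr p) \<partial>M"
  have "(\<integral>\<^sup>+x\<in>ball t R. ennreal (\<bar>f x - ball_average M t R f\<bar> powr p) \<partial>M)
      = (\<integral>\<^sup>+x\<in>ball t R. ennreal (\<bar>(f x - a) + (a - ball_average M t R f)\<bar> powr p) \<partial>M)"
    by simp
  also have "\<dots> \<le> ennreal (2 powr p) * (?I
        + (\<integral>\<^sup>+x\<in>ball t R. ennreal (\<bar>a - ball_average M t R f\<bar> powr p) \<partial>M))"
    by (rule set_nn_integral_abs_add_powr_le[OF assms(1)]) auto
  also have "\<dots> \<le> ennreal (2 powr p) * (?I + ?I)"
    using ball_average_diff_powr_le[OF assms, of t a]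
    by (intro mult_left_mono add_left_mono) (auto simp: set_nn_integral_const_ball abs_minus_commute)
  also have "\<dots> = ennreal (2 powr p * 2) * ?I"
    by (simp add: ennreal_mult mult.assoc mult_2[symmetric])
  finally show ?thesis .
qed

text \<open>On each ball f is split into f - g and g minus its average, with g the smoothing of f at
  scale r: the first part is the smoothing error, the second falls under the Poincare inequality,
  and bounded overlap sums both. Since r \<le> R, the smoothing error also scales like R^p. D does
  not depend on R, and T depends on neither r nor f, so one finite set of balls serves a whole
  sequence.\<close>

lemma oscillation_on_cover_le_energy:
  assumes p: "1 \<le> p" and PI: "poincare_inequality M p"
  obtains D :: real where "0 < D"
    "\<And>R. 0 < R \<Longrightarrow> \<exists>T :: 'a set. finite T \<and> (\<Union>t\<in>T. ball t R) = UNIV \<and>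
      (\<forall>r f. 0 < r \<longrightarrow> r \<le> R \<longrightarrow> f \<in> Lp M p \<longrightarrow>
        (\<Sum>t\<in>T. \<integral>\<^sup>+x\<in>ball t R. ennreal (\<bar>f x - ball_average M t R f\<bar> powr p) \<partial>M)
          \<le> ennreal (D * R powr p) * KS_energy M p r f)"
proof -
  obtain P \<Lambda> where P: "0 < P" "1 \<le> \<Lambda>"
    and "\<forall>g. (\<exists>L. L-lipschitz_on UNIV g) \<longrightarrow> (\<forall>x. \<forall>R>0.
       (\<integral>\<^sup>+y\<in>ball x R. ennreal (\<bar>g y - ball_average M x R g\<bar> powr p) \<partial>M)
       \<le> ennreal (P * R powr p) * (\<integral>\<^sup>+y\<in>ball x (\<Lambda> * R). ennreal (enn2real (Lip g y) powr p) \<partial>M))"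
    using PI unfolding poincare_inequality_def by (elim exE conjE) (rule that)
  then have P_ineq: "(\<integral>\<^sup>+y\<in>ball x R. ennreal (\<bar>g y - ball_average M x R g\<bar> powr p) \<partial>M)
       \<le> ennreal (P * R powr p) * (\<integral>\<^sup>+y\<in>ball x (\<Lambda> * R). ennreal (enn2real (Lip g y) powr p) \<partial>M)"
    if "\<exists>L. L-lipschitz_on UNIV g" "0 < R" for g x R
    using that by simp
  obtain N :: real where N: "1 \<le> N"
    "\<And>R. 0 < R \<Longrightarrow> \<exists>T :: 'a set. finite T \<and> (\<Union>t\<in>T. ball t R) = UNIV \<and>
       (\<forall>x. real (card {t\<in>T. x \<in> ball t (\<Lambda> * R)}) \<le> N)"
    by (rule bounded_overlap_cover[OF P(2)]) (rule that)
  define K2 where "K2 = (2 * K * (1 + K)) powr p"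
  \<comment> \<open>The leading factor 2^p * 2 is the price for exchanging averages, the next 2^p
    that of splitting f; the summands are the smoothing error and the Poincare term.\<close>
  define D where "D = (2 powr p * 2) * 2 powr p * (N * K powr p + P * N * K2)"
  have "0 < K powr p" "0 < K2"
    using K_ge_1 by (simp_all add: K2_def)
  moreover from this have "0 < D"
    using P(1) N(1) by (simp add: D_def add_pos_pos)
  ultimately have pos: "0 < K powr p" "0 < K2" "0 < D"
    by simp_all
  show thesis
  proof (rule that[OF pos(3)])
    fix R :: real assume R: "0 < R"
    obtain T :: "'a set" where T: "finite T" "(\<Union>t\<in>T. ball t R) = UNIV"
      "\<forall>x. real (card {t\<in>T. x \<in> ball t (\<Lambda> * R)}) \<le> N"
      using N(2)[OF R] by (elim exE conjE) (rule that)
    have overlap: "real (card {t\<in>T. x \<in> ball t R}) \<le> N" for x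
    proof -
      have "R \<le> \<Lambda> * R"
        using P(2) R by simp
      then have "card {t\<in>T. x \<in> ball t R} \<le> card {t\<in>T. x \<in> ball t (\<Lambda> * R)}"
        using T(1) by (intro card_mono) (auto intro: less_le_trans)
      then show ?thesis using T(3)[rule_format, of x] by linarith
    qed
    have "(\<Sum>t\<in>T. \<integral>\<^sup>+x\<in>ball t R. ennreal (\<bar>f x - ball_average M t R f\<bar> powr p) \<partial>M)
          \<le> ennreal (D * R powr p) * KS_energy M p r f"
      if r: "0 < r" "r \<le> R" and f: "f \<in> Lp M p" for r f
    proof -
      define g where "g = smoothing r f"
      define E where "E = KS_energy M p r f"
      have f_int: "integrable M f" by (rule Lp_imp_integrable[OF p f])
      have lip: "\<exists>L. L-lipschitz_on UNIV g"
        unfolding g_def by (rule smoothing_lipschitz[OF r(1) f_int])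
      then have [measurable]: "g \<in> borel_measurable M"
        by (auto intro: continuous_measurable lipschitz_on_continuous_on)
      have [measurable]: "f \<in> borel_measurable M"
        by (rule Lp_measurable[OF f])
      have "(\<integral>\<^sup>+x\<in>ball t R. ennreal (\<bar>f x - ball_average M t R f\<bar> powr p) \<partial>M)
        \<le> ennreal (2 powr p * 2 * 2 powr p) *
          ((\<integral>\<^sup>+x\<in>ball t R. ennreal (\<bar>g x - f x\<bar> powr p) \<partial>M)
           + ennreal (P * R powr p) *
             (\<integral>\<^sup>+x\<in>ball t (\<Lambda> * R). ennreal (enn2real (Lip g x) powr p) \<partial>M))" for t
      proof -
        let ?a = "ball_average M t R g"
        have "(\<integral>\<^sup>+x\<in>ball t R. ennreal (\<bar>f x - ball_average M t R f\<bar> powr p) \<partial>M)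
          \<le> ennreal (2 powr p * 2) * (\<integral>\<^sup>+x\<in>ball t R. ennreal (\<bar>f x - ?a\<bar> powr p) \<partial>M)"
          by (rule ball_average_nearly_optimal[OF p f R])
        also have "(\<integral>\<^sup>+x\<in>ball t R. ennreal (\<bar>f x - ?a\<bar> powr p) \<partial>M)
          = (\<integral>\<^sup>+x\<in>ball t R. ennreal (\<bar>(f x - g x) + (g x - ?a)\<bar> powr p) \<partial>M)"
          by simp
        also have "\<dots> \<le> ennreal (2 powr p) *
            ((\<integral>\<^sup>+x\<in>ball t R. ennreal (\<bar>f x - g x\<bar> powr p) \<partial>M)
             + (\<integral>\<^sup>+x\<in>ball t R. ennreal (\<bar>g x - ?a\<bar> powr p) \<partial>M))"
          by (rule set_nn_integral_abs_add_powr_le[OF p]) auto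
        also have "\<dots> \<le> ennreal (2 powr p) *
            ((\<integral>\<^sup>+x\<in>ball t R. ennreal (\<bar>g x - f x\<bar> powr p) \<partial>M)
             + ennreal (P * R powr p) *
               (\<integral>\<^sup>+x\<in>ball t (\<Lambda> * R). ennreal (enn2real (Lip g x) powr p) \<partial>M))"
          by (intro mult_left_mono add_mono P_ineq lip R) (auto simp: abs_minus_commute)
        finally show ?thesis
          by (simp add: ennreal_mult mult.assoc mult_left_mono)
      qed
      then have "(\<Sum>t\<in>T. \<integral>\<^sup>+x\<in>ball t R. ennreal (\<bar>f x - ball_average M t R f\<bar> powr p) \<partial>M)
        \<le> (\<Sum>t\<in>T. ennreal (2 powr p * 2 * 2 powr p) *
          ((\<integral>\<^sup>+x\<in>ball t R. ennreal (\<bar>g x - f x\<bar> powr p) \<partial>M)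
           + ennreal (P * R powr p) *
             (\<integral>\<^sup>+x\<in>ball t (\<Lambda> * R). ennreal (enn2real (Lip g x) powr p) \<partial>M)))"
        by (rule sum_mono)
      also have "\<dots> = ennreal (2 powr p * 2 * 2 powr p) *
          ((\<Sum>t\<in>T. \<integral>\<^sup>+x\<in>ball t R. ennreal (\<bar>g x - f x\<bar> powr p) \<partial>M)
           + ennreal (P * R powr p) *
             (\<Sum>t\<in>T. \<integral>\<^sup>+x\<in>ball t (\<Lambda> * R). ennreal (enn2real (Lip g x) powr p) \<partial>M))"
        by (simp only: sum_distrib_left[symmetric] sum.distrib)
      also have "\<dots> \<le> ennreal (2 powr p * 2 * 2 powr p) *
          (ennreal (N * K powr p * R powr p) * E + ennreal (P * R powr p) * (ennreal (N * K2) * E))"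
      proof (intro mult_left_mono add_mono)
        have "(\<Sum>t\<in>T. \<integral>\<^sup>+x\<in>ball t R. ennreal (\<bar>g x - f x\<bar> powr p) \<partial>M)
          \<le> ennreal N * (\<integral>\<^sup>+x. ennreal (\<bar>g x - f x\<bar> powr p) \<partial>M)"
          by (rule sum_set_nn_integral_le[OF T(1) N(1) overlap])
        also have "\<dots> \<le> ennreal N * (ennreal (K powr p * r powr p) * E)"
          unfolding g_def E_def by (intro mult_left_mono smoothing_error_energy_le p f r) auto
        also have "\<dots> \<le> ennreal N * (ennreal (K powr p * R powr p) * E)"
          using p r by (intro mult_left_mono mult_right_mono ennreal_leI powr_mono2) auto
        also have "\<dots> = ennreal (N * K powr p * R powr p) * E"
          using N(1) by (simp add: ennreal_mult mult.assoc)
        finally show "(\<Sum>t\<in>T. \<integral>\<^sup>+x\<in>ball t R. ennreal (\<bar>g x - f x\<bar> powr p) \<partial>M)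
          \<le> ennreal (N * K powr p * R powr p) * E" .
        have "(\<Sum>t\<in>T. \<integral>\<^sup>+x\<in>ball t (\<Lambda> * R). ennreal (enn2real (Lip g x) powr p) \<partial>M)
          \<le> ennreal N * (\<integral>\<^sup>+x. ennreal (enn2real (Lip g x) powr p) \<partial>M)"
          by (rule sum_set_nn_integral_le[OF T(1) N(1) T(3)[rule_format]])
        also have "\<dots> \<le> ennreal N * (ennreal K2 * E)"
          unfolding g_def E_def K2_def by (intro mult_left_mono Lip_smoothing_energy_le p f r) auto
        also have "\<dots> = ennreal (N * K2) * E"
          using N(1) pos by (simp add: ennreal_mult mult.assoc)
        finally show "(\<Sum>t\<in>T. \<integral>\<^sup>+x\<in>ball t (\<Lambda> * R). ennreal (enn2real (Lip g x) powr p) \<partial>M)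
          \<le> ennreal (N * K2) * E" .
      qed auto
      also have "\<dots> = (ennreal (2 powr p * 2 * 2 powr p) *
          (ennreal (N * K powr p * R powr p) + ennreal (P * R powr p) * ennreal (N * K2))) * E"
        by (simp add: distrib_right mult.assoc)
      also have "ennreal (2 powr p * 2 * 2 powr p) *
          (ennreal (N * K powr p * R powr p) + ennreal (P * R powr p) * ennreal (N * K2))
          = ennreal (D * R powr p)"
      proof -
        have "ennreal (N * K powr p * R powr p) + ennreal (P * R powr p) * ennreal (N * K2)
          = ennreal (N * K powr p * R powr p + P * R powr p * (N * K2))"
          using N(1) P pos by (simp add: ennreal_mult[symmetric] ennreal_plus[symmetric] del: ennreal_plus)
        moreover have "ennreal (2 powr p * 2 * 2 powr p) *
            ennreal (N * K powr p * R powr p + P * R powr p * (N * K2))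
          = ennreal (2 powr p * 2 * 2 powr p * (N * K powr p * R powr p + P * R powr p * (N * K2)))"
          using N(1) P pos by (intro ennreal_mult[symmetric]) auto
        moreover have "2 powr p * 2 * 2 powr p * (N * K powr p * R powr p + P * R powr p * (N * K2))
          = D * R powr p"
          by (simp add: D_def algebra_simps)
        ultimately show ?thesis by simp
      qed
      finally show ?thesis by (simp add: E_def)
    qed
    then show "\<exists>T :: 'a set. finite T \<and> (\<Union>t\<in>T. ball t R) = UNIV \<and>
      (\<forall>r f. 0 < r \<longrightarrow> r \<le> R \<longrightarrow> f \<in> Lp M p \<longrightarrow>
        (\<Sum>t\<in>T. \<integral>\<^sup>+x\<in>ball t R. ennreal (\<bar>f x - ball_average M t R f\<bar> powr p) \<partial>M)
          \<le> ennreal (D * R powr p) * KS_energy M p r f)"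
      using T(1,2) by (intro exI[of _ T]) simp
  qed
qed

end

section \<open>Bounded energy turns weak into strong convergence\<close>

context compact_doubling
begin

text \<open>The indicator of the ball serves both as density and as dominating function in
  \<open>pairing_in_Lp_dual\<close>: it equals its own powers, even the power 0, as
  \<open>0 powr 0 = 0\<close>.\<close>

lemma ball_average_weak_tendsto:
  assumes p: "1 \<le> p" and weak: "Lp_weak_conv M p fs f"
  shows "(\<lambda>n. ball_average M t R (fs n)) \<longlonglongrightarrow> ball_average M t R f"
proof -
  have "(\<lambda>g. LINT x|M. g x * indicator (ball t R) x) \<in> Lp_dual M p"
  proof (rule pairing_in_Lp_dual[OF p])
    have "\<bar>indicat_real (ball t R) x\<bar> powr p = indicator (ball t R) x" for x
      by (auto simp: indicator_def)
    then show "indicator (ball t R) \<in> Lp M p"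
      by (simp add: Lp_def less_top[symmetric])
    show "indicator (ball t R) \<in> borel_measurable M"
      by (rule borel_measurable_indicator[OF ball_sets])
    show "\<bar>indicator (ball t R) x\<bar> \<le> \<bar>indicator (ball t R) x\<bar> powr (p - 1)" for x
      by (auto simp: indicator_def)
  qed
  then have "(\<lambda>n. LINT x|M. fs n x * indicator (ball t R) x) \<longlonglongrightarrow> (LINT x|M. f x * indicator (ball t R) x)"
    using weak by (auto simp: Lp_weak_conv_def)
  from tendsto_mult_right[OF this, of "1 / measure M (ball t R)"]
  show ?thesis
    by (simp add: ball_average_def set_lebesgue_integral_def mult.commute)
qed

text \<open>On each ball both functions are compared with one constant, the average of the weak
  limit. The energy controls the distance to their own averages, and weak convergence moves these
  finitely many averages to the common constants.\<close>

lemma weak_conv_bounded_energy_cauchy: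
  assumes p: "1 \<le> p" and PI: "poincare_inequality M p"
    and weak: "Lp_weak_conv M p fs f"
    and r: "\<And>n. 0 < r n" "r \<longlonglongrightarrow> 0"
    and bound: "0 < E" "\<And>n. n \<in> S \<Longrightarrow> KS_energy M p (r n) (fs n) \<le> ennreal E"
    and \<delta>: "0 < \<delta>"
  shows "\<exists>n0. \<forall>n\<in>S. \<forall>m\<in>S. n0 \<le> n \<longrightarrow> n0 \<le> m \<longrightarrow> (LINT x|M. \<bar>fs n x - fs m x\<bar> powr p) \<le> \<delta>"
proof -
  obtain D where D: "0 < D"
    "\<And>R. 0 < R \<Longrightarrow> \<exists>T :: 'a set. finite T \<and> (\<Union>t\<in>T. ball t R) = UNIV \<and>
      (\<forall>r f. 0 < r \<longrightarrow> r \<le> R \<longrightarrow> f \<in> Lp M p \<longrightarrow>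
        (\<Sum>t\<in>T. \<integral>\<^sup>+x\<in>ball t R. ennreal (\<bar>f x - ball_average M t R f\<bar> powr p) \<partial>M)
          \<le> ennreal (D * R powr p) * KS_energy M p r f)"
    by (rule oscillation_on_cover_le_energy[OF p PI]) (rule that)
  \<comment> \<open>One factor \<open>2 powr p\<close> for passing from \<open>fs n\<close> to
    \<open>c t\<close>, one for comparing \<open>fs n\<close> with \<open>fs m\<close>. R is then
    chosen so that the energy contributes \<delta> / 4; the averages contribute another quarter,
    which makes \<delta> / 2 for each of n and m.\<close>
  define k where "k = 2 powr p * 2 powr p"
  have k: "k > 0" by (simp add: k_def)
  define R where "R = (\<delta> / (4 * k * D * E)) powr (1 / p)"
  have R: "0 < R" "R powr p = \<delta> / (4 * k * D * E)"
    using p k D(1) bound(1) \<delta> by (auto simp: R_def powr_powr)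
  have DRE: "k * (D * R powr p * E) = \<delta> / 4"
    using k D(1) bound(1) by (simp add: R field_simps)
  obtain T :: "'a set" where T: "finite T" "(\<Union>t\<in>T. ball t R) = UNIV"
    and "\<forall>r f. 0 < r \<longrightarrow> r \<le> R \<longrightarrow> f \<in> Lp M p \<longrightarrow>
        (\<Sum>t\<in>T. \<integral>\<^sup>+x\<in>ball t R. ennreal (\<bar>f x - ball_average M t R f\<bar> powr p) \<partial>M)
          \<le> ennreal (D * R powr p) * KS_energy M p r f"
    using D(2)[OF R(1)] by (elim exE conjE) (rule that)
  then have T_osc: "(\<Sum>t\<in>T. \<integral>\<^sup>+x\<in>ball t R. ennreal (\<bar>f x - ball_average M t R f\<bar> powr p) \<partial>M)
          \<le> ennreal (D * R powr p) * KS_energy M p r f"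
    if "0 < r" "r \<le> R" "f \<in> Lp M p" for r f
    using that by simp
  have Lp: "fs n \<in> Lp M p" "f \<in> Lp M p" for n
    using weak by (auto simp: Lp_weak_conv_def)
  have [measurable]: "fs n \<in> borel_measurable M" for n
    by (rule Lp_measurable[OF Lp(1)])
  define c where "c t = ball_average M t R f" for t
  define q where "q n = (\<Sum>t\<in>T. \<bar>ball_average M t R (fs n) - c t\<bar> powr p * measure M (ball t R))" for n
  have "q \<longlonglongrightarrow> (\<Sum>t\<in>T. 0 * measure M (ball t R))"
    unfolding q_def
  proof (intro tendsto_sum tendsto_mult_right)
    fix t
    have "(\<lambda>n. ball_average M t R (fs n) - c t) \<longlonglongrightarrow> 0"
      using ball_average_weak_tendsto[OF p weak, of t R] by (simp add: c_def LIM_zero)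
    then have "(\<lambda>n. \<bar>ball_average M t R (fs n) - c t\<bar>) \<longlonglongrightarrow> 0"
      by (rule tendsto_rabs_zero)
    then show "(\<lambda>n. \<bar>ball_average M t R (fs n) - c t\<bar> powr p) \<longlonglongrightarrow> 0"
      by (rule tendsto_zero_powrI[OF _ tendsto_const]) (use p in auto)
  qed
  then have "\<forall>\<^sub>F n in sequentially. q n < \<delta> / (4 * k)"
    using \<delta> k by (intro order_tendstoD) auto
  moreover have "\<forall>\<^sub>F n in sequentially. r n < R"
    using r(2) R(1) by (intro order_tendstoD)
  ultimately have "\<forall>\<^sub>F n in sequentially. q n < \<delta> / (4 * k) \<and> r n < R"
    by (rule eventually_conj)
  then obtain n0 where n0: "\<And>n. n0 \<le> n \<Longrightarrow> q n < \<delta> / (4 * k) \<and> r n < R"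
    by (auto simp: eventually_sequentially)
  have q_nonneg: "0 \<le> q n" for n
    unfolding q_def by (intro sum_nonneg) auto
  define G where "G n = (\<Sum>t\<in>T. \<integral>\<^sup>+x\<in>ball t R. ennreal (\<bar>fs n x - c t\<bar> powr p) \<partial>M)" for n
  have G: "ennreal (2 powr p) * G n \<le> ennreal (\<delta> / 2)" if n: "n \<in> S" "n0 \<le> n" for n
  proof -
    have "(\<integral>\<^sup>+x\<in>ball t R. ennreal (\<bar>fs n x - c t\<bar> powr p) \<partial>M) \<le> ennreal (2 powr p) *
        ((\<integral>\<^sup>+x\<in>ball t R. ennreal (\<bar>fs n x - ball_average M t R (fs n)\<bar> powr p) \<partial>M)
        + ennreal (\<bar>ball_average M t R (fs n) - c t\<bar> powr p * measure M (ball t R)))" for t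
    proof -
      have "(\<integral>\<^sup>+x\<in>ball t R. ennreal (\<bar>fs n x - c t\<bar> powr p) \<partial>M) = (\<integral>\<^sup>+x\<in>ball t R.
          ennreal (\<bar>(fs n x - ball_average M t R (fs n)) + (ball_average M t R (fs n) - c t)\<bar> powr p) \<partial>M)"
        by simp
      also have "\<dots> \<le> ennreal (2 powr p) *
        ((\<integral>\<^sup>+x\<in>ball t R. ennreal (\<bar>fs n x - ball_average M t R (fs n)\<bar> powr p) \<partial>M)
        + (\<integral>\<^sup>+x\<in>ball t R. ennreal (\<bar>ball_average M t R (fs n) - c t\<bar> powr p) \<partial>M))"
        by (rule set_nn_integral_abs_add_powr_le[OF p]) auto
      finally show ?thesis by (simp add: set_nn_integral_const_ball)
    qed
    then have "G n \<le> (\<Sum>t\<in>T. ennreal (2 powr p) *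
        ((\<integral>\<^sup>+x\<in>ball t R. ennreal (\<bar>fs n x - ball_average M t R (fs n)\<bar> powr p) \<partial>M)
        + ennreal (\<bar>ball_average M t R (fs n) - c t\<bar> powr p * measure M (ball t R))))"
      unfolding G_def by (rule sum_mono)
    also have "\<dots> = ennreal (2 powr p) *
        ((\<Sum>t\<in>T. \<integral>\<^sup>+x\<in>ball t R. ennreal (\<bar>fs n x - ball_average M t R (fs n)\<bar> powr p) \<partial>M)
        + ennreal (q n))"
      unfolding q_def by (simp add: sum_distrib_left[symmetric] sum.distrib)
    also have "\<dots> \<le> ennreal (2 powr p) * (ennreal (D * R powr p) * ennreal E + ennreal (\<delta> / (4 * k)))"
    proof (intro mult_left_mono add_mono ennreal_leI)
      have "(\<Sum>t\<in>T. \<integral>\<^sup>+x\<in>ball t R. ennreal (\<bar>fs n x - ball_average M t R (fs n)\<bar> powr p) \<partial>M)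
        \<le> ennreal (D * R powr p) * KS_energy M p (r n) (fs n)"
        using n0[OF n(2)] by (intro T_osc r(1) Lp) auto
      also have "\<dots> \<le> ennreal (D * R powr p) * ennreal E"
        by (intro mult_left_mono bound(2) n) auto
      finally show "(\<Sum>t\<in>T. \<integral>\<^sup>+x\<in>ball t R. ennreal (\<bar>fs n x - ball_average M t R (fs n)\<bar> powr p) \<partial>M)
        \<le> ennreal (D * R powr p) * ennreal E" .
    qed (use n0[OF n(2)] in auto)
    also have "\<dots> = ennreal (2 powr p * (D * R powr p * E + \<delta> / (4 * k)))"
      using D(1) bound(1) \<delta> k
      by (simp add: ennreal_mult[symmetric] ennreal_plus[symmetric] del: ennreal_plus)
    finally have "ennreal (2 powr p) * G n
        \<le> ennreal (2 powr p) * ennreal (2 powr p * (D * R powr p * E + \<delta> / (4 * k)))"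
      by (rule mult_left_mono) simp
    also have "\<dots> = ennreal (k * (D * R powr p * E) + k * (\<delta> / (4 * k)))"
      using D(1) bound(1) \<delta> k
      by (simp add: ennreal_mult[symmetric] k_def algebra_simps)
    also have "k * (D * R powr p * E) + k * (\<delta> / (4 * k)) = \<delta> / 2"
      unfolding DRE using k by simp
    finally show ?thesis .
  qed
  have "(LINT x|M. \<bar>fs n x - fs m x\<bar> powr p) \<le> \<delta>"
    if nm: "n \<in> S" "m \<in> S" "n0 \<le> n" "n0 \<le> m" for n m
  proof -
    have "ennreal (LINT x|M. \<bar>fs n x - fs m x\<bar> powr p) = (\<integral>\<^sup>+x. ennreal (\<bar>fs n x - fs m x\<bar> powr p) \<partial>M)"
      by (intro nn_integral_eq_integral[symmetric] Lp_integrable Lp_diff p Lp) auto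
    also have "\<dots> \<le> (\<integral>\<^sup>+x. (\<Sum>t\<in>T. ennreal (\<bar>fs n x - fs m x\<bar> powr p) * indicator (ball t R) x) \<partial>M)"
    proof (rule nn_integral_mono)
      fix x
      obtain t where t: "t \<in> T" "x \<in> ball t R" using T(2) by blast
      then have "ennreal (\<bar>fs n x - fs m x\<bar> powr p) = ennreal (\<bar>fs n x - fs m x\<bar> powr p) * indicator (ball t R) x"
        by simp
      also have "\<dots> \<le> (\<Sum>t\<in>T. ennreal (\<bar>fs n x - fs m x\<bar> powr p) * indicator (ball t R) x)"
        by (rule member_le_sum[OF t(1)]) (use T(1) in auto)
      finally show "ennreal (\<bar>fs n x - fs m x\<bar> powr p)
        \<le> (\<Sum>t\<in>T. ennreal (\<bar>fs n x - fs m x\<bar> powr p) * indicator (ball t R) x)" .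
    qed
    also have "\<dots> = (\<Sum>t\<in>T. \<integral>\<^sup>+x\<in>ball t R. ennreal (\<bar>fs n x - fs m x\<bar> powr p) \<partial>M)"
      by (rule nn_integral_sum) measurable
    also have "\<dots> \<le> (\<Sum>t\<in>T. ennreal (2 powr p) *
        ((\<integral>\<^sup>+x\<in>ball t R. ennreal (\<bar>fs n x - c t\<bar> powr p) \<partial>M)
        + (\<integral>\<^sup>+x\<in>ball t R. ennreal (\<bar>fs m x - c t\<bar> powr p) \<partial>M)))"
    proof (rule sum_mono)
      fix t
      have "(\<integral>\<^sup>+x\<in>ball t R. ennreal (\<bar>fs n x - fs m x\<bar> powr p) \<partial>M)
          = (\<integral>\<^sup>+x\<in>ball t R. ennreal (\<bar>(fs n x - c t) + (c t - fs m x)\<bar> powr p) \<partial>M)"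
        by simp
      also have "\<dots> \<le> ennreal (2 powr p) *
        ((\<integral>\<^sup>+x\<in>ball t R. ennreal (\<bar>fs n x - c t\<bar> powr p) \<partial>M)
        + (\<integral>\<^sup>+x\<in>ball t R. ennreal (\<bar>c t - fs m x\<bar> powr p) \<partial>M))"
        by (rule set_nn_integral_abs_add_powr_le[OF p]) auto
      finally show "(\<integral>\<^sup>+x\<in>ball t R. ennreal (\<bar>fs n x - fs m x\<bar> powr p) \<partial>M) \<le> ennreal (2 powr p) *
        ((\<integral>\<^sup>+x\<in>ball t R. ennreal (\<bar>fs n x - c t\<bar> powr p) \<partial>M)
        + (\<integral>\<^sup>+x\<in>ball t R. ennreal (\<bar>fs m x - c t\<bar> powr p) \<partial>M))"
        by (simp only: abs_minus_commute)
    qed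
    also have "\<dots> = ennreal (2 powr p) * G n + ennreal (2 powr p) * G m"
      by (simp add: G_def sum_distrib_left sum.distrib distrib_left)
    also have "\<dots> \<le> ennreal (\<delta> / 2) + ennreal (\<delta> / 2)"
      by (intro add_mono G nm)
    also have "\<dots> = ennreal \<delta>"
      using \<delta> by (simp add: ennreal_plus[symmetric] del: ennreal_plus)
    finally show ?thesis using \<delta> by simp
  qed
  then show ?thesis by blast
qed

text \<open>For fixed n in S the Cauchy estimate holds for all large m in S, and weak lower
  semicontinuity replaces \<open>fs m\<close> by f. Outside S the distance is zero.\<close>

lemma weak_conv_bounded_energy_strong:
  assumes p: "1 \<le> p" and PI: "poincare_inequality M p"
    and weak: "Lp_weak_conv M p fs f"
    and r: "\<And>n. 0 < r n" "r \<longlonglongrightarrow> 0"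
    and bound: "0 < E" "\<And>n. n \<in> S \<Longrightarrow> KS_energy M p (r n) (fs n) \<le> ennreal E"
    and S: "infinite S"
  shows "Lp_strong_conv M p (\<lambda>n. if n \<in> S then fs n else f) f"
proof -
  have Lp: "fs n \<in> Lp M p" "f \<in> Lp M p" for n
    using weak by (auto simp: Lp_weak_conv_def)
  show ?thesis
  proof (rule Lp_strong_convI[OF p])
    show "(\<lambda>n. LINT x|M. \<bar>(if n \<in> S then fs n else f) x - f x\<bar> powr p) \<longlonglongrightarrow> 0"
    proof (rule LIMSEQ_I)
      fix \<delta> :: real assume \<delta>: "0 < \<delta>"
      then obtain n0 where n0: "\<And>n m. n \<in> S \<Longrightarrow> m \<in> S \<Longrightarrow> n0 \<le> n \<Longrightarrow> n0 \<le> m \<Longrightarrow>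
          (LINT x|M. \<bar>fs n x - fs m x\<bar> powr p) \<le> \<delta> / 2"
        using weak_conv_bounded_energy_cauchy[OF p PI weak r bound, where \<delta> = "\<delta> / 2" and S = S] by auto
      have close: "(LINT x|M. \<bar>fs n x - f x\<bar> powr p) \<le> \<delta> / 2" if n: "n \<in> S" "n0 \<le> n" for n
      proof (rule weak_limit_Lp_distance_le[OF p weak Lp(1)])
        \<comment> \<open>The estimate is available for m in S only; as S is infinite, it holds
          infinitely often, which is all that \<open>weak_limit_Lp_distance_le\<close> asks
          for.\<close>
        have "\<exists>\<^sub>F m in sequentially. m \<in> S"
          using S by (simp add: frequently_cofinite flip: cofinite_eq_sequentially)
        moreover have "\<forall>\<^sub>F m in sequentially. n0 \<le> m"
          by (rule eventually_ge_at_top)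
        ultimately show "\<exists>\<^sub>F m in sequentially. (LINT x|M. \<bar>fs n x - fs m x\<bar> powr p) \<le> \<delta> / 2"
          by (rule frequently_rev_mp[OF _ eventually_mono]) (use n0 n in auto)
      qed
      have "norm ((LINT x|M. \<bar>(if n \<in> S then fs n else f) x - f x\<bar> powr p) - 0) < \<delta>" if "n0 \<le> n" for n
      proof (cases "n \<in> S")
        case True
        have "0 \<le> (LINT x|M. \<bar>fs n x - f x\<bar> powr p)"
          by (rule integral_nonneg_AE) auto
        with close[OF True that] True \<delta> show ?thesis by simp
      qed (use \<delta> in simp)
      then show "\<exists>n0. \<forall>n\<ge>n0. norm ((LINT x|M. \<bar>(if n \<in> S then fs n else f) x - f x\<bar> powr p) - 0) < \<delta>"
        by blast
    qed
  qed (use Lp in auto)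
qed

end

section \<open>From compact Cheeger spaces to Mosco convergence\<close>

lemma compact_cheeger_space_doubling:
  assumes compact: "compact (UNIV :: 'a::metric_space set)" and cheeger: "cheeger_space (M :: 'a measure) p"
  obtains C where "compact_doubling M C"
proof -
  have radon: "radon_measure M" and "volume_doubling M"
    using cheeger by (auto simp: cheeger_space_def)
  then obtain C where "0 < C" and C_all: "\<forall>x. \<forall>r>0.
        0 < emeasure M (ball x (2 * r)) \<and>
        emeasure M (ball x (2 * r)) \<le> ennreal C * emeasure M (ball x r) \<and>
        ennreal C * emeasure M (ball x r) < \<infinity>"
    unfolding volume_doubling_def by (elim exE conjE) (rule that)
  then have C: "0 < C" "\<And>x r. 0 < r \<Longrightarrow> 0 < emeasure M (ball x (2 * r))"
    "\<And>x r. 0 < r \<Longrightarrow> emeasure M (ball x (2 * r)) \<le> ennreal C * emeasure M (ball x r)"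
    by simp_all
  have sets: "sets M = sets borel"
    using radon by (simp add: radon_measure_def)
  then have space: "space M = UNIV"
    using sets_eq_imp_space_eq[OF sets] by simp
  have "\<forall>K. compact K \<longrightarrow> emeasure M K < \<infinity>"
    using radon unfolding radon_measure_def by (elim conjE)
  with compact have "emeasure M UNIV < \<infinity>" by blast
  then interpret finite_measure M
    by (intro finite_measureI) (simp add: space)
  \<comment> \<open>The maximum ensures that the constant is at least 1.\<close>
  have "compact_doubling M (max 1 C)"
  proof unfold_locales
    fix x :: 'a and r :: real assume r: "0 < r"
    have "ennreal (measure M (ball x (2 * r))) \<le> ennreal (C * measure M (ball x r))"
      using C(3)[OF r, of x] C(1) by (simp add: emeasure_eq_measure ennreal_mult)
    then have "measure M (ball x (2 * r)) \<le> C * measure M (ball x r)"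
      using C(1) by simp
    also have "\<dots> \<le> max 1 C * measure M (ball x r)"
      by (intro mult_right_mono) auto
    finally show "measure M (ball x (2 * r)) \<le> max 1 C * measure M (ball x r)" .
    \<comment> \<open>\<open>volume_doubling\<close> asserts positivity at radius 2 r, so it is
      applied at r / 2.\<close>
    show "0 < measure M (ball x r)"
      using C(2)[of "r / 2" x] r by (simp add: emeasure_eq_measure)
  qed (use compact sets in auto)
  then show thesis by (rule that)
qed

theorem theorem5p5:
  fixes M :: "'a::metric_space measure"
    and p :: real
    and r :: "nat \<Rightarrow> real"
    and \<E> :: "('a \<Rightarrow> real) \<Rightarrow> ennreal"
  assumes "1 \<le> p"
    and "compact (UNIV :: 'a set)"
    and "cheeger_space M p"
    and "\<And>n. 0 < r n"
    and "r \<longlonglongrightarrow> 0"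
    and "\<And>f. f \<in> Lp M p \<Longrightarrow> \<E> f < \<infinity> \<longleftrightarrow> f \<in> KS_space M p"
    and "gamma_converges M p (\<lambda>n f. enn2ereal (KS_energy M p (r n) f)) (\<lambda>f. enn2ereal (\<E> f))"
  shows "mosco_converges M p (\<lambda>n f. enn2ereal (KS_energy M p (r n) f)) (\<lambda>f. enn2ereal (\<E> f))"
proof -
  obtain C where "compact_doubling M C"
    using compact_cheeger_space_doubling[OF assms(2,3)] by blast
  then interpret compact_doubling M C .
  have PI: "poincare_inequality M p"
    using assms(3) by (simp add: cheeger_space_def)
  have "enn2ereal (\<E> f) \<le> liminf (\<lambda>n. enn2ereal (KS_energy M p (r n) (fs n)))"
    if weak: "Lp_weak_conv M p fs f" for fs f
  proof (rule ccontr)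
    assume "\<not> ?thesis"
    \<comment> \<open>A real number c is inserted between the two sides; this also covers an
      infinite value of the limit energy.\<close>
    then obtain c where c: "liminf (\<lambda>n. enn2ereal (KS_energy M p (r n) (fs n))) < ereal c"
      "ereal c < enn2ereal (\<E> f)"
      using ereal_dense2 by (metis not_le)
    define S where "S = {n. enn2ereal (KS_energy M p (r n) (fs n)) < ereal c}"
    have "\<exists>\<^sub>F n in sequentially. n \<in> S"
    proof (rule ccontr)
      assume "\<not> ?thesis"
      then have "\<forall>\<^sub>F n in sequentially. ereal c \<le> enn2ereal (KS_energy M p (r n) (fs n))"
        by (simp add: frequently_def S_def not_less)
      then have "ereal c \<le> liminf (\<lambda>n. enn2ereal (KS_energy M p (r n) (fs n)))"
        by (rule Liminf_bounded)
      with c(1) show False by simp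
    qed
    then have inf: "infinite S"
      by (simp add: frequently_cofinite flip: cofinite_eq_sequentially)
    \<comment> \<open>The maximum with 1 provides the positive bound that the compactness result
      requires.\<close>
    have bound: "KS_energy M p (r n) (fs n) \<le> ennreal (max 1 c)" if "n \<in> S" for n
    proof -
      have "enn2ereal (KS_energy M p (r n) (fs n)) \<le> ereal (max 1 c)"
        using that by (auto simp: S_def intro: order.trans[OF less_imp_le])
      then show ?thesis
        by (simp add: less_eq_ennreal.rep_eq enn2ereal_ennreal)
    qed
    define g where "g n = (if n \<in> S then fs n else f)" for n
    have "Lp_strong_conv M p g f"
      unfolding g_def
      by (rule weak_conv_bounded_energy_strong[OF assms(1) PI weak assms(4,5) _ bound inf]) auto
    then have "enn2ereal (\<E> f) \<le> liminf (\<lambda>n. enn2ereal (KS_energy M p (r n) (g n)))"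
      using assms(7) by (auto simp: gamma_converges_def)
    \<comment> \<open>The \<Gamma>-lower bound for g puts its energies eventually above c, while on
      S they equal those of \<open>fs\<close> and lie below c. So S would be finite.\<close>
    with c(2) have "ereal c < liminf (\<lambda>n. enn2ereal (KS_energy M p (r n) (g n)))"
      by simp
    then have "\<forall>\<^sub>F n in sequentially. ereal c < enn2ereal (KS_energy M p (r n) (g n))"
      by (rule less_LiminfD)
    then have "\<forall>\<^sub>F n in sequentially. n \<notin> S"
      by eventually_elim (auto simp: g_def S_def)
    with inf show False
      by (simp add: eventually_cofinite flip: cofinite_eq_sequentially)
  qed
  then show ?thesis
    using assms(7) by (simp add: mosco_converges_def gamma_converges_def)
qed

end
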